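(* Let $k$ be a finite extension of $\mathbb{F}_q$, let $\phi:\mathbb{F}_q[T]\to k\{\tau\}$ be a Drinfeld module, and let $v\in\operatorname{End}(\phi)$. Then $\deg\det(v)=\deg_\tau(v)$. Consequently $-\deg\det(\cdot)$ is a valuation on the ring $R=\mathbb{F}_q[v,\phi_T]$, and it extends to a valuation of the fraction field $\mathbb{F}_q(v,T)$ of $R$.
   Context: $k\{\tau\}$ is the skew polynomial ring over $k$ with $\tau c=c^q\tau$; $\deg_\tau$ is the degree in $\tau$, with $\deg_\tau 0=-\infty$, and $\deg 0=-\infty$ for polynomials. A Drinfeld module of rank $r\ge1$ is an injective $\mathbb{F}_q$-algebra homomorphism $\phi:\mathbb{F}_q[T]\to k\{\tau\}$ with $\phi_T=\sum_{i=0}^rg_i\tau^i$, $g_r\ne0$; its characteristic $\mathfrak{p}$ is the minimal polynomial of $g_0$ over $\mathbb{F}_q$. $\operatorname{End}(\phi)=\{u\in k\{\tau\}:u\phi_T=\phi_Tu\}$. $\mathbb{F}_q[T]$ is identified with $\mathbb{F}_q[\phi_T]$; $R=\mathbb{F}_q[v,\phi_T]$ is a commutative domain. For $u\in\operatorname{End}(\phi)$, $\det(u)\in\mathbb{F}_q[T]$ is the determinant of $u$ acting on the Tate module $T_{\mathfrak{l}}(\phi)=\varprojlim_m\phi[\mathfrak{l}^m]$ for any prime $\mathfrak{l}\ne\mathfrak{p}$ (independent of $\mathfrak{l}$), where $\phi[a]$ is the set of roots in $\bar k$ of $\phi_a$ acting by $z\mapsto\sum c_iz^{q^i}$. *)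

theory Defs
  imports
    "HOL-Algebra.Algebra"
    "HOL-Algebra.Algebraic_Closure_Type"
    "HOL-Computational_Algebra.Computational_Algebra"
    "HOL-Combinatorics.Permutations"
    "HOL-Library.Cardinality"
    "HOL-Library.Extended_Real"
begin

section \<open>Degrees, valuations and fraction fields\<close>

definition ext_degree :: "'a::zero poly \<Rightarrow> ereal" where
  "ext_degree p = (if p = 0 then -\<infinity> else ereal (real (Polynomial.degree p)))"

definition valuation_on :: "('a, 'm) ring_scheme \<Rightarrow> ('a \<Rightarrow> ereal) \<Rightarrow> bool" where
  "valuation_on R w \<longleftrightarrow> domain R \<and>
     (\<forall>x\<in>carrier R. w x \<noteq> -\<infinity> \<and> (w x = \<infinity> \<longleftrightarrow> x = \<zero>\<^bsub>R\<^esub>)) \<and>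
     (\<forall>x\<in>carrier R. \<forall>y\<in>carrier R. w (x \<otimes>\<^bsub>R\<^esub> y) = w x + w y) \<and>
     (\<forall>x\<in>carrier R. \<forall>y\<in>carrier R. min (w x) (w y) \<le> w (x \<oplus>\<^bsub>R\<^esub> y))"

definition is_fraction_field ::
  "('a, 'm) ring_scheme \<Rightarrow> ('b, 'n) ring_scheme \<Rightarrow> ('a \<Rightarrow> 'b) \<Rightarrow> bool" where
  "is_fraction_field R K j \<longleftrightarrow> Ring.field K \<and> j \<in> ring_hom R K \<and> inj_on j (carrier R) \<and>
     (\<forall>z\<in>carrier K. \<exists>a\<in>carrier R. \<exists>b\<in>carrier R - {\<zero>\<^bsub>R\<^esub>}. z \<otimes>\<^bsub>K\<^esub> j b = j a)"

section \<open>Determinants of endomorphisms of free modules of finite rank\<close>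

definition ring_det :: "('a, 'm) ring_scheme \<Rightarrow> nat \<Rightarrow> (nat \<Rightarrow> nat \<Rightarrow> 'a) \<Rightarrow> 'a" where
  "ring_det R n A =
     (\<Oplus>\<^bsub>R\<^esub>p\<in>{p. p permutes {..<n}}.
        (if evenperm p then \<one>\<^bsub>R\<^esub> else \<ominus>\<^bsub>R\<^esub> \<one>\<^bsub>R\<^esub>) \<otimes>\<^bsub>R\<^esub> (\<Otimes>\<^bsub>R\<^esub>i\<in>{..<n}. A i (p i)))"

definition is_module_basis ::
  "('a, 'm) ring_scheme \<Rightarrow> ('a, 'b, 'n) module_scheme \<Rightarrow> nat \<Rightarrow> (nat \<Rightarrow> 'b) \<Rightarrow> bool" where
  "is_module_basis R M n b \<longleftrightarrow> (\<forall>i<n. b i \<in> carrier M) \<and>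
     (\<forall>x\<in>carrier M. \<exists>!c. c \<in> {..<n} \<rightarrow>\<^sub>E carrier R \<and>
        x = (\<Oplus>\<^bsub>M\<^esub>i\<in>{..<n}. c i \<odot>\<^bsub>M\<^esub> b i))"

definition module_det ::
  "('a, 'm) ring_scheme \<Rightarrow> ('a, 'b, 'n) module_scheme \<Rightarrow> ('b \<Rightarrow> 'b) \<Rightarrow> 'a" where
  "module_det R M f = (THE d. \<exists>n b A. is_module_basis R M n b \<and>
     (\<forall>i<n. \<forall>j<n. A i j \<in> carrier R) \<and>
     (\<forall>j<n. f (b j) = (\<Oplus>\<^bsub>M\<^esub>i\<in>{..<n}. A i j \<odot>\<^bsub>M\<^esub> b i)) \<and>
     d = ring_det R n A)"

section \<open>Skew polynomials\<close>

text \<open>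
  The polynomial with coefficients \<open>c\<^sub>0, c\<^sub>1, \<dots>\<close> stands for the skew polynomial
  \<open>\<Sum>i. c\<^sub>i \<tau>\<^sup>i\<close>, with coefficients to the left of the powers of \<open>\<tau>\<close>. Addition and
  degree are the ones of \<^typ>\<open>'k poly\<close>; the product of \<^typ>\<open>'k poly\<close> is not used.
\<close>

definition skew_mult :: "nat \<Rightarrow> 'k::field poly \<Rightarrow> 'k poly \<Rightarrow> 'k poly" where
  "skew_mult q f g =
     (\<Sum>i\<le>Polynomial.degree f. \<Sum>j\<le>Polynomial.degree g.
        Polynomial.monom (Polynomial.coeff f i * Polynomial.coeff g j ^ (q ^ i)) (i + j))"

definition skew_poly_ring :: "nat \<Rightarrow> 'k::field poly ring" where
  "skew_poly_ring q =
     \<lparr>carrier = UNIV, monoid.mult = skew_mult q, monoid.one = 1, ring.zero = 0, ring.add = (+)\<rparr>"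

definition skew_eval :: "nat \<Rightarrow> 'k::field poly \<Rightarrow> 'k alg_closure \<Rightarrow> 'k alg_closure" where
  "skew_eval q f z = (\<Sum>i\<le>Polynomial.degree f. to_ac (Polynomial.coeff f i) * z ^ (q ^ i))"

section \<open>Drinfeld modules\<close>

text \<open>
  The type \<^typ>\<open>'f\<close> is the field \<open>\<bbbF>\<^sub>q\<close>, so \<open>q = CARD('f)\<close>, and \<open>\<iota>\<close> is the embedding
  that makes \<^typ>\<open>'k\<close> an extension of it.
\<close>

definition is_field_embedding :: "('f::field \<Rightarrow> 'k::field) \<Rightarrow> bool" where
  "is_field_embedding \<iota> \<longleftrightarrow> \<iota> 1 = 1 \<and>
     (\<forall>x y. \<iota> (x + y) = \<iota> x + \<iota> y) \<and> (\<forall>x y. \<iota> (x * y) = \<iota> x * \<iota> y)"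

definition drinfeld_module ::
  "('f::finite_field \<Rightarrow> 'k::field) \<Rightarrow> nat \<Rightarrow> ('f poly \<Rightarrow> 'k poly) \<Rightarrow> bool" where
  "drinfeld_module \<iota> r \<phi> \<longleftrightarrow> is_field_embedding \<iota> \<and>
     (\<forall>c. \<phi> [:c:] = [:\<iota> c:]) \<and>
     (\<forall>a b. \<phi> (a + b) = \<phi> a + \<phi> b) \<and>
     (\<forall>a b. \<phi> (a * b) = skew_mult CARD('f) (\<phi> a) (\<phi> b)) \<and>
     inj \<phi> \<and> r \<ge> 1 \<and> Polynomial.degree (\<phi> [:0, 1:]) = r"

definition drinfeld_char ::
  "('f::finite_field \<Rightarrow> 'k::field) \<Rightarrow> ('f poly \<Rightarrow> 'k poly) \<Rightarrow> 'f poly" where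
  "drinfeld_char \<iota> \<phi> = (let g0 = Polynomial.coeff (\<phi> [:0, 1:]) 0 in
     THE p. lead_coeff p = 1 \<and> poly (map_poly \<iota> p) g0 = 0 \<and>
       (\<forall>p'. p' \<noteq> 0 \<longrightarrow> poly (map_poly \<iota> p') g0 = 0 \<longrightarrow>
          Polynomial.degree p \<le> Polynomial.degree p'))"

definition drinfeld_End :: "('f::finite_field poly \<Rightarrow> 'k::field poly) \<Rightarrow> 'k poly set" where
  "drinfeld_End \<phi> =
     {u. skew_mult CARD('f) u (\<phi> [:0, 1:]) = skew_mult CARD('f) (\<phi> [:0, 1:]) u}"

definition drinfeld_torsion ::
  "('f::finite_field poly \<Rightarrow> 'k::field poly) \<Rightarrow> 'f poly \<Rightarrow> 'k alg_closure set" where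
  "drinfeld_torsion \<phi> a = {z. skew_eval CARD('f) (\<phi> a) z = 0}"

section \<open>Tate modules and the determinant\<close>

text \<open>
  An element of the completion of \<open>\<bbbF>\<^sub>q[T]\<close> at \<open>l\<close>, the inverse limit of the rings
  \<open>\<bbbF>\<^sub>q[T]/(l\<^sup>m)\<close>, is the sequence of its reduced representatives modulo \<open>l\<^sup>m\<close>.
\<close>

definition adic_ring :: "'f::finite_field poly \<Rightarrow> (nat \<Rightarrow> 'f poly) ring" where
  "adic_ring l =
     \<lparr>carrier = {a. \<forall>m. a m = a (Suc m) mod l ^ m},
      monoid.mult = (\<lambda>a b m. (a m * b m) mod l ^ m),
      monoid.one = (\<lambda>m. 1 mod l ^ m),
      ring.zero = (\<lambda>m. 0),
      ring.add = (\<lambda>a b m. (a m + b m) mod l ^ m)\<rparr>"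

definition adic_of :: "'f::finite_field poly \<Rightarrow> 'f poly \<Rightarrow> nat \<Rightarrow> 'f poly" where
  "adic_of l d = (\<lambda>m. d mod l ^ m)"

text \<open>
  The fields \<^const>\<open>monoid.mult\<close> and \<^const>\<open>monoid.one\<close> are present because a module record
  extends a ring record; they have no meaning for a module.
\<close>

definition tate_module ::
  "('f::finite_field poly \<Rightarrow> 'k::field poly) \<Rightarrow> 'f poly
     \<Rightarrow> (nat \<Rightarrow> 'f poly, nat \<Rightarrow> 'k alg_closure) module" where
  "tate_module \<phi> l =
     \<lparr>carrier = {x. \<forall>m. x m \<in> drinfeld_torsion \<phi> (l ^ m) \<and>
                        skew_eval CARD('f) (\<phi> l) (x (Suc m)) = x m},
      monoid.mult = undefined,
      monoid.one = undefined,
      ring.zero = (\<lambda>m. 0),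
      ring.add = (\<lambda>x y m. x m + y m),
      module.smult = (\<lambda>a x m. skew_eval CARD('f) (\<phi> (a m)) (x m))\<rparr>"

definition tate_map :: "nat \<Rightarrow> 'k::field poly \<Rightarrow> (nat \<Rightarrow> 'k alg_closure) \<Rightarrow> nat \<Rightarrow> 'k alg_closure" where
  "tate_map q u x = (\<lambda>m. skew_eval q u (x m))"

text \<open>
  The determinant is the polynomial whose image in the completion at \<open>l\<close> is the determinant
  on the Tate module at \<open>l\<close>, for all primes \<open>l\<close> different from the characteristic. Primes
  are represented by their monic generators.
\<close>

definition drinfeld_det ::
  "('f::finite_field \<Rightarrow> 'k::field) \<Rightarrow> ('f poly \<Rightarrow> 'k poly) \<Rightarrow> 'k poly \<Rightarrow> 'f poly" where
  "drinfeld_det \<iota> \<phi> u = (THE d. \<forall>l. Factorial_Ring.irreducible l \<and> lead_coeff l = 1 \<and>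
       l \<noteq> drinfeld_char \<iota> \<phi> \<longrightarrow>
       adic_of l d = module_det (adic_ring l) (tate_module \<phi> l) (tate_map CARD('f) u))"

text \<open>The subring \<open>\<bbbF>\<^sub>q[v, \<phi>\<^sub>T]\<close> of the ring of skew polynomials.\<close>

definition drinfeld_subring ::
  "('f::finite_field \<Rightarrow> 'k::field) \<Rightarrow> ('f poly \<Rightarrow> 'k poly) \<Rightarrow> 'k poly \<Rightarrow> 'k poly ring" where
  "drinfeld_subring \<iota> \<phi> v = (skew_poly_ring CARD('f))
     \<lparr>carrier := generate_ring (skew_poly_ring CARD('f))
        (range (\<lambda>c. [:\<iota> c:]) \<union> {v, \<phi> [:0, 1:]})\<rparr>"

end

theory Submission
  imports Defs "Jordan_Normal_Form.Char_Poly" "HOL-Number_Theory.Cong"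
begin

text \<open>
  Over \<open>K\<close>, an algebraic closure of \<open>k\<close>, the skew polynomial ring \<open>K{\<tau>}\<close> is a free \<open>K[T]\<close>-module
  with basis \<open>1, \<tau>, \<dots>, \<tau>\<^sup>r\<^sup>-\<^sup>1\<close>, on which \<open>T\<close> acts as right multiplication by \<open>\<phi>\<^sub>T\<close>. Right multiplication by
  an endomorphism \<open>u\<close> is \<open>K[T]\<close>-linear; let \<open>C\<close> be its matrix.

  Giving \<open>T\<^sup>m \<tau>\<^sup>j\<close> the weight \<open>r m + j\<close>, exactly one permutation, the cyclic shift by \<open>deg u\<close>, reaches the
  top weight in \<open>det C\<close>, so \<open>deg det C = deg u\<close>. Comparing \<open>C\<close> with its Frobenius twist through left
  multiplication by \<open>\<tau>\<close> shows that the coefficients of \<open>det C\<close> lie in \<open>\<bbbF>\<^sub>q\<close>.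

  Generating functions in the style of Anderson pair \<open>K{\<tau>}\<close> with \<open>\<phi>[a]\<close>, with values in \<open>K[T]/(a)\<close>. The
  pairing is nondegenerate because \<open>\<phi>[a]\<close> has \<open>q\<close> to the power \<open>r deg a\<close> elements, hence \<open>det C\<close> is
  modulo \<open>a\<close> the determinant of \<open>u\<close> on \<open>\<phi>[a]\<close>. For \<open>a = l\<^sup>m\<close> this identifies \<open>det C\<close> with the determinant
  on the Tate module at \<open>l\<close>.
\<close>

section \<open>Skew polynomials as additive operators\<close>

text \<open>\<open>drinfeld_det\<close> is a definite description over all primes at once, so one
  polynomial over F_q must be exhibited with the right residue modulo every \<open>l ^ m\<close>.
  \<open>det C\<close> serves all primes, but it is built over K; this is why descent to F_q is
  needed before anything can be compared with a Tate module. Coefficients stand on the left and T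
  acts from the right, so scalars and T commute although scalars and \<tau> do not: that is what
  makes a commutative K[T] act. The pairing matrix is never inverted modulo a: its determinant
  shares no root with a, hence can be cancelled. The structure of torsion is obtained from counting
  alone: away from the characteristic \<phi>_a is separable, the number of points is the full power
  of q, and injective maps between finite sets of equal size supply freeness, rank and surjectivity.
  Once the degree of the determinant equals the degree in \<tau>, the valuation laws on R are the
  degree laws of skew polynomials, and the values on fractions are forced to be differences.\<close>

definition skew_ev :: "nat \<Rightarrow> 'k::field poly \<Rightarrow> 'k \<Rightarrow> 'k" where
  "skew_ev q f z = (\<Sum>i\<le>degree f. coeff f i * z ^ (q ^ i))"

lemma skew_ev_altdef:
  assumes "degree f \<le> n"
  shows "skew_ev q f z = (\<Sum>i\<le>n. coeff f i * z ^ (q ^ i))"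
  unfolding skew_ev_def
  by (rule sum.mono_neutral_left) (use assms in \<open>auto simp: coeff_eq_0\<close>)

lemma skew_ev_0 [simp]: "skew_ev q 0 z = 0"
  by (simp add: skew_ev_def)

lemma skew_ev_add: "skew_ev q (f + g) z = skew_ev q f z + skew_ev q g z"
proof -
  let ?n = "max (degree f) (degree g)"
  have "degree (f + g) \<le> ?n" by (rule degree_add_le_max)
  thus ?thesis
    by (simp add: skew_ev_altdef[of _ ?n] ring_distribs sum.distrib)
qed

lemma skew_ev_smult [simp]: "skew_ev q (smult c f) z = c * skew_ev q f z"
proof -
  have "degree (smult c f) \<le> degree f" by (rule degree_smult_le)
  thus ?thesis
    by (simp add: skew_ev_altdef[of _ "degree f"] sum_distrib_left mult_ac)
qed

lemma skew_ev_minus: "skew_ev q (- f) z = - skew_ev q f z"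
  using skew_ev_smult[of q "-1" f z] by simp

lemma skew_ev_diff: "skew_ev q (f - g) z = skew_ev q f z - skew_ev q g z"
  using skew_ev_add[of q f "- g" z] by (simp add: skew_ev_minus)

lemma skew_ev_sum: "skew_ev q (sum f A) z = (\<Sum>x\<in>A. skew_ev q (f x) z)"
  by (induction A rule: infinite_finite_induct) (auto simp: skew_ev_add)

lemma skew_ev_monom [simp]: "skew_ev q (monom c n) z = c * z ^ (q ^ n)"
proof -
  have "skew_ev q (monom c n) z = (\<Sum>i\<le>n. coeff (monom c n) i * z ^ (q ^ i))"
    by (rule skew_ev_altdef) (rule degree_monom_le)
  also have "\<dots> = (\<Sum>i\<in>{n}. coeff (monom c n) i * z ^ (q ^ i))"
    by (rule sum.mono_neutral_right) auto
  finally show ?thesis by simp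
qed

lemma skew_ev_const [simp]: "skew_ev q [:c:] z = c * z"
  using skew_ev_monom[of q c 0 z] by (simp add: monom_0)

section \<open>Root counts over an algebraically closed field\<close>

lemma infinite_UNIV_alg_closed: "infinite (UNIV :: 'k::alg_closed_field set)"
proof
  assume fin: "finite (UNIV :: 'k set)"
  \<comment> \<open>Euclid's trick: over a finite field this polynomial has positive degree but
    takes the value 1 everywhere.\<close>
  define P where "P = (\<Prod>a\<in>(UNIV :: 'k set). [:- a, 1:]) + 1"
  have "degree (\<Prod>a\<in>(UNIV :: 'k set). [:- a, 1:]) = card (UNIV :: 'k set)"
    by (subst degree_prod_eq_sum_degree) auto
  moreover have "card (UNIV :: 'k set) > 0"
    using fin by (simp add: card_gt_0_iff)
  ultimately have "degree P > 0"
    unfolding P_def by (subst degree_add_eq_left) auto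
  then obtain x where "poly P x = 0"
    using alg_closed_imp_poly_has_root by blast
  moreover have "poly P x = 1"
    using fin by (auto simp: P_def poly_prod prod_zero_iff)
  ultimately show False by simp
qed

text \<open>The linear factors form a multiset of size \<open>degree p\<close>; a repeated root
  would also be a root of the derivative, so the multiset is a set.\<close>

lemma card_roots_eq_degree:
  fixes p :: "'k::alg_closed_field poly"
  assumes "p \<noteq> 0" and sep: "\<And>x. poly p x = 0 \<Longrightarrow> poly (pderiv p) x \<noteq> 0"
  shows "card {x. poly p x = 0} = degree p"
proof -
  obtain A where A: "size A = degree p" "p = smult (lead_coeff p) (\<Prod>x\<in>#A. [:- x, 1:])"
    using alg_closed_imp_factorization[of p] assms by auto
  have roots: "set_mset A = {x. poly p x = 0}"
    using assms(1) by (subst A(2)) (auto simp: poly_prod_mset)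
  have "count A x \<le> 1" for x
  proof (rule ccontr)
    assume "\<not> count A x \<le> 1"
    hence "{#x, x#} \<subseteq># A"
      by (simp add: subseteq_mset_def)
    then obtain B where "A = {#x, x#} + B"
      by (metis subset_mset.add_diff_inverse)
    hence "p = [:- x, 1:] * ([:- x, 1:] * smult (lead_coeff p) (\<Prod>x\<in>#B. [:- x, 1:]))"
      by (subst A(2)) (simp add: mult_ac)
    then obtain r where "p = [:- x, 1:] * ([:- x, 1:] * r)" by blast
    moreover have "poly ([:- x, 1:] * ([:- x, 1:] * r)) x = 0"
      "poly (pderiv ([:- x, 1:] * ([:- x, 1:] * r))) x = 0"
      by (simp_all only: pderiv_mult poly_mult poly_add) simp_all
    ultimately have "poly p x = 0" "poly (pderiv p) x = 0"
      by metis+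
    with sep show False by blast
  qed
  hence "count A x = (if x \<in># A then 1 else 0)" for x
    by (cases "x \<in># A") (auto simp: not_in_iff le_antisym Suc_le_eq)
  hence "A = mset_set (set_mset A)"
    by (intro multiset_eqI) (simp add: count_mset_set')
  hence "size A = card (set_mset A)"
    by (metis size_mset_set)
  thus ?thesis using A(1) roots by simp
qed

text \<open>Besides q > 1, two facts carry the theory: additivity of x^q, which lets composition of
  operators match \<open>skew_mult\<close>, and q = 0 in the field, which makes derivatives of
  additive polynomials constant.\<close>

locale frobenius_power =
  fixes q :: nat and field_type :: "'k::alg_closed_field itself"
  assumes q_gt_1: "q > 1"
    and power_q_add: "\<And>x y :: 'k. (x + y) ^ q = x ^ q + y ^ q"
    and of_nat_q: "of_nat q = (0 :: 'k)"
begin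

abbreviation ev :: "'k poly \<Rightarrow> 'k \<Rightarrow> 'k" where "ev \<equiv> skew_ev q"
abbreviation smul :: "'k poly \<Rightarrow> 'k poly \<Rightarrow> 'k poly" (infixl "\<star>" 70) where "smul \<equiv> skew_mult q"

lemma power_qn_add: "(x + y :: 'k) ^ (q ^ n) = x ^ (q ^ n) + y ^ (q ^ n)"
  by (induction n) (simp_all add: power_mult power_q_add mult.commute[of q])

lemma zero_power_qn [simp]: "(0 :: 'k) ^ (q ^ n) = 0"
  using q_gt_1 by (simp add: power_0_left)

lemma power_qn_minus: "(- x :: 'k) ^ (q ^ n) = - (x ^ (q ^ n))"
  using power_qn_add[of x "- x" n] by (simp add: eq_neg_iff_add_eq_0 add.commute)

lemma power_qn_sum: "(\<Sum>x\<in>A. f x :: 'k) ^ (q ^ n) = (\<Sum>x\<in>A. f x ^ (q ^ n))"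
  by (induction A rule: infinite_finite_induct) (auto simp: power_qn_add)

lemma ev_arg_add: "ev f (x + y) = ev f x + ev f y"
  by (simp add: skew_ev_def power_qn_add ring_distribs sum.distrib)

lemma ev_arg_0 [simp]: "ev f 0 = 0"
  by (simp add: skew_ev_def)

lemma ev_arg_minus: "ev f (- x) = - ev f x"
  by (simp add: skew_ev_def power_qn_minus sum_negf)

lemma ev_arg_diff: "ev f (x - y) = ev f x - ev f y"
  using ev_arg_add[of f x "- y"] by (simp add: ev_arg_minus)

lemma ev_arg_sum: "ev f (sum g A) = (\<Sum>x\<in>A. ev f (g x))"
  by (induction A rule: infinite_finite_induct) (auto simp: ev_arg_add)

lemma ev_mult: "ev (f \<star> g) z = ev f (ev g z)"
proof -
  have "ev (f \<star> g) z = (\<Sum>i\<le>degree f. \<Sum>j\<le>degree g. coeff f i * coeff g j ^ (q ^ i) * z ^ (q ^ (i + j)))"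
    by (simp add: skew_mult_def skew_ev_sum)
  also have "\<dots> = (\<Sum>i\<le>degree f. coeff f i * (\<Sum>j\<le>degree g. (coeff g j * z ^ (q ^ j)) ^ (q ^ i)))"
    by (simp add: sum_distrib_left power_mult_distrib power_mult [symmetric] power_add mult_ac)
  also have "\<dots> = ev f (ev g z)"
    by (simp add: skew_ev_def power_qn_sum)
  finally show ?thesis .
qed

text \<open>The passage to an ordinary polynomial of degree q^(deg f) gives access to root bounds
  and to the existence of roots.\<close>

definition additive_poly :: "'k poly \<Rightarrow> 'k poly" where
  "additive_poly f = (\<Sum>i\<le>degree f. monom (coeff f i) (q ^ i))"

lemma poly_additive_poly: "poly (additive_poly f) z = ev f z"
  by (simp add: additive_poly_def skew_ev_def poly_sum poly_monom)

lemma degree_additive_poly: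
  assumes "f \<noteq> 0"
  shows "degree (additive_poly f) = q ^ degree f" "additive_poly f \<noteq> 0"
proof -
  have "additive_poly f = monom (lead_coeff f) (q ^ degree f) + (\<Sum>i<degree f. monom (coeff f i) (q ^ i))"
    unfolding additive_poly_def by (subst lessThan_Suc_atMost[symmetric], subst sum.lessThan_Suc) simp
  moreover have "degree (\<Sum>i<degree f. monom (coeff f i) (q ^ i)) < q ^ degree f"
  proof (rule degree_sum_less)
    fix i assume "i \<in> {..<degree f}"
    thus "degree (monom (coeff f i) (q ^ i)) < q ^ degree f"
      using q_gt_1 by (intro le_less_trans[OF degree_monom_le]) simp
  qed (use q_gt_1 in auto)
  ultimately show "degree (additive_poly f) = q ^ degree f"
    using assms by (simp add: degree_add_eq_left degree_monom_eq)
  thus "additive_poly f \<noteq> 0"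
    using q_gt_1 by (metis degree_0 power_eq_0_iff not_one_less_zero)
qed

lemma roots_ev:
  assumes "f \<noteq> 0"
  shows "finite {z. ev f z = 0}" "card {z. ev f z = 0} \<le> q ^ degree f"
  using poly_roots_finite[OF degree_additive_poly(2)[OF assms]]
    card_poly_roots_bound[OF degree_additive_poly(2)[OF assms]]
    degree_additive_poly(1)[OF assms]
  by (simp_all add: poly_additive_poly)

text \<open>A nonzero skew polynomial has finitely many zeros and the field is infinite. Each ring
  law of \<open>skew_mult\<close> below is reduced by this to a law of composition, through
  \<open>ev_mult\<close>.\<close>

lemma ev_inject: "(\<And>z. ev f z = ev g z) \<Longrightarrow> f = g"
  using roots_ev(1)[of "f - g"] infinite_UNIV_alg_closed[where 'k = 'k]
  by (auto simp: skew_ev_diff)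

lemma ev_surj:
  assumes "f \<noteq> 0"
  obtains x where "ev f x = z"
proof -
  have "degree (additive_poly f + [:- z:]) = q ^ degree f"
    using q_gt_1 degree_additive_poly(1)[OF assms] by (subst degree_add_eq_left) auto
  moreover have "q ^ degree f > 0" using q_gt_1 by simp
  ultimately obtain x where "poly (additive_poly f + [:- z:]) x = 0"
    using alg_closed_imp_poly_has_root by metis
  thus ?thesis by (intro that[of x]) (simp add: poly_additive_poly)
qed

text \<open>As q = 0 in the field, only the term in X^(q^0) survives differentiation. The derivative
  is the nonzero constant \<open>coeff f 0\<close>, so all roots are simple.\<close>

lemma card_roots_separable:
  assumes "coeff f 0 \<noteq> 0"
  shows "card {z. ev f z = 0} = q ^ degree f"
proof -
  let ?P = "additive_poly f"
  have f: "f \<noteq> 0" using assms by auto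
  note [simp] = degree_additive_poly[OF f]
  have "pderiv ?P = (\<Sum>i\<le>degree f. monom (of_nat (q ^ i) * coeff f i) (q ^ i - 1))"
    by (simp add: additive_poly_def pderiv_sum pderiv_monom)
  also have "\<dots> = (\<Sum>i\<in>{0}. monom (of_nat (q ^ i) * coeff f i) (q ^ i - 1))"
    by (rule sum.mono_neutral_right) (auto simp: of_nat_q power_0_left)
  finally have "pderiv ?P = [:coeff f 0:]" by (simp add: monom_0)
  thus ?thesis
    using card_roots_eq_degree[of ?P] assms by (simp add: poly_additive_poly)
qed

end

section \<open>Degrees of skew products and the ring laws\<close>

lemma skew_mult_0_left [simp]: "skew_mult q 0 g = 0"
  by (simp add: skew_mult_def)

lemma coeff_skew_mult_top:
  "coeff (skew_mult q f g) (degree f + degree g) = lead_coeff f * lead_coeff g ^ (q ^ degree f)"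
proof -
  have "coeff (skew_mult q f g) (degree f + degree g) =
      (\<Sum>i\<le>degree f. \<Sum>j\<le>degree g. if i = degree f \<and> j = degree g
         then lead_coeff f * lead_coeff g ^ (q ^ degree f) else 0)"
    unfolding skew_mult_def coeff_sum coeff_monom by (intro sum.cong) auto
  also have "\<dots> = (\<Sum>i\<le>degree f. if i = degree f then lead_coeff f * lead_coeff g ^ (q ^ degree f) else 0)"
    by (intro sum.cong) auto
  finally show ?thesis by simp
qed

lemma degree_skew_mult_le: "degree (skew_mult q f g) \<le> degree f + degree g"
  unfolding skew_mult_def
  by (intro degree_sum_le) (auto intro!: order.trans[OF degree_monom_le])

lemma skew_mult_nonzero:
  assumes "f \<noteq> 0" "g \<noteq> 0"
  shows "skew_mult q f g \<noteq> 0"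
  using coeff_skew_mult_top[of q f g] assms by (metis coeff_0 leading_coeff_0_iff mult_eq_0_iff power_not_zero)

lemma degree_skew_mult:
  assumes "f \<noteq> 0" "g \<noteq> 0"
  shows "degree (skew_mult q f g) = degree f + degree g"
proof (rule antisym[OF degree_skew_mult_le le_degree])
  show "coeff (skew_mult q f g) (degree f + degree g) \<noteq> 0"
    using assms by (simp add: coeff_skew_mult_top)
qed

lemma coeff_0_skew_mult: "coeff (skew_mult q f g) 0 = coeff f 0 * coeff g 0"
proof -
  have "coeff (skew_mult q f g) 0 =
      (\<Sum>i\<le>degree f. \<Sum>j\<le>degree g. if i = 0 \<and> j = 0 then coeff f 0 * coeff g 0 else 0)"
    unfolding skew_mult_def coeff_sum coeff_monom by (intro sum.cong) auto
  also have "\<dots> = (\<Sum>i\<le>degree f. if i = 0 then coeff f 0 * coeff g 0 else 0)"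
    by (intro sum.cong) auto
  finally show ?thesis by simp
qed

context frobenius_power
begin

lemma ev_one [simp]: "ev 1 z = z"
  by (metis mult_1 one_pCons skew_ev_const)

lemma smul_0_right [simp]: "f \<star> 0 = 0"
  by (rule ev_inject) (simp add: ev_mult)

lemma smul_add_left: "(f + g) \<star> h = f \<star> h + g \<star> h"
  by (rule ev_inject) (simp add: ev_mult skew_ev_add)

lemma smul_add_right: "f \<star> (g + h) = f \<star> g + f \<star> h"
  by (rule ev_inject) (simp add: ev_mult skew_ev_add ev_arg_add)

lemma smul_sum_left: "sum f A \<star> g = (\<Sum>x\<in>A. f x \<star> g)"
  by (rule ev_inject) (simp add: ev_mult skew_ev_sum)

lemma smul_sum_right: "g \<star> sum f A = (\<Sum>x\<in>A. g \<star> f x)"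
  by (rule ev_inject) (simp add: ev_mult skew_ev_sum ev_arg_sum)

lemma smul_smult_left: "smult c f \<star> g = smult c (f \<star> g)"
  by (rule ev_inject) (simp add: ev_mult)

lemma smul_assoc: "(f \<star> g) \<star> h = f \<star> (g \<star> h)"
  by (rule ev_inject) (simp add: ev_mult)

lemma smul_one_left [simp]: "1 \<star> f = f"
  by (rule ev_inject) (simp add: ev_mult)

lemma smul_one_right [simp]: "f \<star> 1 = f"
  by (rule ev_inject) (simp add: ev_mult)

lemma smul_monom_monom: "monom 1 i \<star> monom 1 j = (monom 1 (i + j) :: 'k poly)"
  by (rule ev_inject) (simp add: ev_mult power_mult[symmetric] power_add mult.commute)

abbreviation \<tau> :: "nat \<Rightarrow> 'k poly" where "\<tau> \<equiv> monom 1"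

end

text \<open>Terms of pairwise distinct degrees cannot cancel. The application is to degrees that
  differ modulo r.\<close>

lemma degree_sum_distinct_degrees:
  fixes g :: "'a \<Rightarrow> 'b::comm_ring_1 poly"
  assumes "finite S" "S \<noteq> {}" "\<And>x. x \<in> S \<Longrightarrow> g x \<noteq> 0" "inj_on (\<lambda>x. degree (g x)) S"
  shows "sum g S \<noteq> 0 \<and> (\<exists>x\<in>S. degree (sum g S) = degree (g x)) \<and> (\<forall>x\<in>S. degree (g x) \<le> degree (sum g S))"
  using assms
proof (induction S rule: finite_ne_induct)
  case (insert x S)
  have IH: "sum g S \<noteq> 0" "\<exists>x\<in>S. degree (sum g S) = degree (g x)" "\<forall>x\<in>S. degree (g x) \<le> degree (sum g S)"
    using insert.IH insert.prems by auto
  have sum: "sum g (insert x S) = g x + sum g S"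
    using insert.hyps by simp
  have ne: "degree (g x) \<noteq> degree (sum g S)"
    using IH(2) insert.prems(2) insert.hyps(3) by (auto simp: inj_on_def)
  show ?case
  proof (cases "degree (g x) < degree (sum g S)")
    case True
    hence "degree (sum g (insert x S)) = degree (sum g S)"
      unfolding sum by (rule degree_add_eq_right)
    with True IH show ?thesis by auto
  next
    case False
    with ne have "degree (g x) > degree (sum g S)" by simp
    hence "degree (sum g (insert x S)) = degree (g x)"
      unfolding sum by (rule degree_add_eq_left)
    with \<open>degree (g x) > degree (sum g S)\<close> IH show ?thesis by (auto intro: order.trans)
  qed
qed auto

text \<open>(1 + X)^q - X^q - 1 has degree below q yet vanishes at all q elements of F_q, where x^q
  = x. Hence it is zero, and its coefficients are the binomials in question.\<close>

lemma of_nat_choose_CARD_eq_0: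
  assumes "0 < i" "i < CARD('f::finite_field)"
  shows "of_nat (CARD('f) choose i) = (0 :: 'f)"
proof -
  let ?q = "CARD('f)"
  define P :: "'f poly" where "P = [:1, 1:] ^ ?q - monom 1 ?q - 1"
  have q: "?q > 0" using assms by simp
  have "P = 0"
  proof (rule ccontr)
    assume "P \<noteq> 0"
    have "poly P x = 0" for x
      by (simp add: P_def poly_power poly_monom finite_field_power_card_eq_same)
    hence "?q \<le> degree P"
      using card_poly_roots_bound[OF \<open>P \<noteq> 0\<close>] by simp
    moreover have "degree P < ?q"
    proof (rule degree_lessI)
      show "P \<noteq> 0 \<or> ?q > 0" using q by simp
      have "degree ([:1, 1 :: 'f:] ^ ?q) \<le> ?q"
        using degree_power_le[of "[:1, 1 :: 'f:]" ?q] by simp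
      moreover have "coeff ([:1, 1 :: 'f:] ^ ?q) ?q = 1"
        by (simp add: coeff_linear_poly_power)
      ultimately show "\<forall>k\<ge>?q. coeff P k = 0"
        using q by (auto simp: P_def coeff_1 coeff_eq_0)
    qed
    ultimately show False by simp
  qed
  hence "coeff P i = 0" by simp
  thus ?thesis
    using assms by (simp add: P_def coeff_linear_poly_power coeff_1)
qed

lemma is_field_embedding_hom:
  assumes "is_field_embedding e"
  shows "field_hom e"
proof
  have add: "e (x + y) = e x + e y" for x y using assms by (auto simp: is_field_embedding_def)
  show "e 0 = 0" by (metis add add.right_neutral add_left_imp_eq)
qed (use assms in \<open>auto simp: is_field_embedding_def\<close>)

lemma frobenius_power_CARD:
  fixes e :: "'f::finite_field \<Rightarrow> 'k::alg_closed_field"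
  assumes "is_field_embedding e"
  shows "frobenius_power TYPE('k) CARD('f)"
proof
  interpret e: field_hom e by (rule is_field_embedding_hom[OF assms])
  let ?q = "CARD('f)"
  have "card {0, 1 :: 'f} \<le> ?q" by (rule card_mono) auto
  thus q: "?q > 1" by simp
  have z: "of_nat (?q choose i) = (0 :: 'k)" if "0 < i" "i < ?q" for i
    using of_nat_choose_CARD_eq_0[OF that] by (metis e.hom_of_nat e.hom_zero)
  show "of_nat ?q = (0 :: 'k)" using z[of 1] q by simp
  fix x y :: 'k
  have "(x + y) ^ ?q = (\<Sum>k\<le>?q. of_nat (?q choose k) * x ^ k * y ^ (?q - k))"
    by (rule binomial_ring)
  also have "\<dots> = (\<Sum>k\<in>{0, ?q}. of_nat (?q choose k) * x ^ k * y ^ (?q - k))"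
    by (rule sum.mono_neutral_right) (auto simp: z)
  finally show "(x + y) ^ ?q = x ^ ?q + y ^ ?q" using q by simp
qed

section \<open>Drinfeld modules over an algebraically closed field\<close>

locale drinfeld_closed =
  fixes e :: "'f::finite_field \<Rightarrow> 'k::alg_closed_field" and r :: nat and F :: "'f poly \<Rightarrow> 'k poly"
  assumes drinfeld: "drinfeld_module e r F"

sublocale drinfeld_closed \<subseteq> frobenius_power "CARD('f)" "TYPE('k)"
  using drinfeld frobenius_power_CARD unfolding drinfeld_module_def by blast

sublocale drinfeld_closed \<subseteq> e: field_hom e
  using drinfeld is_field_embedding_hom unfolding drinfeld_module_def by blast

sublocale drinfeld_closed \<subseteq> ep: map_poly_inj_idom_hom e ..

context drinfeld_closed
begin

notation smul (infixl "\<star>" 70)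

definition FT :: "'k poly" where "FT = F [:0, 1:]"

definition act :: "'f poly \<Rightarrow> 'k \<Rightarrow> 'k" where "act a z = ev (F a) z"

lemma F_const: "F [:c:] = [:e c:]" and F_add: "F (a + b) = F a + F b"
  and F_mult: "F (a * b) = F a \<star> F b" and inj_F: "inj F"
  and r_pos: "r \<ge> 1" and degree_FT: "degree FT = r"
  using drinfeld unfolding drinfeld_module_def FT_def by auto

lemma F_0 [simp]: "F 0 = 0"
  using F_const[of 0] by simp

lemma F_1 [simp]: "F 1 = 1"
  using F_const[of 1] by (simp add: one_pCons)

lemma FT_nonzero: "FT \<noteq> 0"
  using degree_FT r_pos by auto

lemma F_pCons: "F (pCons c a) = [:e c:] + F a \<star> FT"
proof -
  have "pCons c a = [:c:] + a * [:0, 1:]" by simp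
  thus ?thesis by (metis F_add F_mult F_const FT_def)
qed

lemma F_commute: "F a \<star> F b = F b \<star> F a"
  by (metis F_mult mult.commute)

lemma e_power_q [simp]: "e c ^ CARD('f) = e c"
  by (metis e.hom_power finite_field_power_card_eq_same)

lemma e_power_qn [simp]: "e c ^ CARD('f) ^ n = e c"
  by (induction n) (simp_all add: power_mult)

lemma ev_e_scale: "ev f (e c * z) = e c * ev f z"
  by (simp add: skew_ev_def power_mult_distrib sum_distrib_left mult_ac)

lemma act_0_left [simp]: "act 0 z = 0" and act_1 [simp]: "act 1 z = z"
  and act_const: "act [:c:] z = e c * z"
  and act_0_right [simp]: "act a 0 = 0"
  and act_add_left: "act (a + b) z = act a z + act b z"
  and act_add_right: "act a (y + z) = act a y + act a z"
  and act_diff_right: "act a (y - z) = act a y - act a z"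
  and act_mult: "act (a * b) z = act a (act b z)"
  and act_sum_right: "act a (sum g A) = (\<Sum>x\<in>A. act a (g x))"
  by (simp_all add: act_def F_const F_add F_mult skew_ev_add ev_mult ev_arg_add ev_arg_diff ev_arg_sum)

lemma act_minus_left: "act (- a) z = - act a z"
  using act_add_left[of a "- a" z] by (simp add: eq_neg_iff_add_eq_0 add.commute)

lemma act_diff_left: "act (a - b) z = act a z - act b z"
  using act_add_left[of a "- b" z] by (simp add: act_minus_left)

lemma act_commute: "act a (act b z) = act b (act a z)"
  by (metis act_mult mult.commute)

lemma F_eq_0_iff [simp]: "F a = 0 \<longleftrightarrow> a = 0"
  using inj_F F_0 by (metis injD)

lemma degree_F: "a \<noteq> 0 \<Longrightarrow> degree (F a) = r * degree a"
proof (induction a)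
  case (pCons c a)
  show ?case
  proof (cases "a = 0")
    case False
    have "degree (F a \<star> FT) = r * degree a + r"
      using False pCons.IH by (simp add: degree_skew_mult FT_nonzero degree_FT)
    moreover have "degree (F (pCons c a)) = degree (F a \<star> FT)"
      unfolding F_pCons by (rule degree_add_eq_right) (use calculation r_pos in simp)
    ultimately show ?thesis using False by simp
  qed (simp add: F_const)
qed simp

text \<open>Taking the coefficient of \<tau>^0 is multiplicative, so that coefficient of \<phi>_a is
  a(g_0); whether it vanishes decides separability.\<close>

lemma coeff_0_F: "coeff (F a) 0 = poly (map_poly e a) (coeff FT 0)"
proof (induction a)
  case (pCons c a)
  thus ?case by (simp add: F_pCons coeff_0_skew_mult map_poly_pCons mult.commute)
qed simp

section \<open>Torsion points and the action of K[T] on K{\<tau>}\<close>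

definition tors :: "'f poly \<Rightarrow> 'k set" where "tors a = {z. act a z = 0}"

lemma finite_tors: "a \<noteq> 0 \<Longrightarrow> finite (tors a)"
  using roots_ev(1)[of "F a"] by (simp add: tors_def act_def)

lemma card_tors:
  assumes "poly (map_poly e a) (coeff FT 0) \<noteq> 0"
  shows "card (tors a) = CARD('f) ^ (r * degree a)"
  using card_roots_separable[of "F a"] assms degree_F[of a]
  by (cases "a = 0") (auto simp: tors_def act_def coeff_0_F)

lemma act_surj:
  assumes "a \<noteq> 0"
  obtains x where "act a x = z"
  using assms ev_surj[of "F a" z] unfolding act_def F_eq_0_iff by metis

text \<open>The \<open>K[T]\<close>-module structure, in which \<open>T\<close> acts as right multiplication by \<open>\<phi>\<^sub>T\<close>.\<close>

definition pact :: "'k poly \<Rightarrow> 'k poly \<Rightarrow> 'k poly" where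
  "pact P f = fold_coeffs (\<lambda>c g. smult c f + g \<star> FT) P 0"

lemma pact_0_left [simp]: "pact 0 f = 0"
  by (simp add: pact_def)

lemma pact_pCons: "pact (pCons c P) f = smult c f + pact P f \<star> FT"
  by (cases "c = 0 \<and> P = 0") (auto simp: pact_def)

lemma pact_0_right [simp]: "pact P 0 = 0"
  by (induction P) (simp_all add: pact_pCons)

lemma pact_add_left: "pact (P + Q) f = pact P f + pact Q f"
  by (induction P Q rule: poly_induct2) (simp_all add: pact_pCons smult_add_left smul_add_left)

lemma pact_sum_left: "pact (sum g A) f = (\<Sum>x\<in>A. pact (g x) f)"
  by (induction A rule: infinite_finite_induct) (auto simp: pact_add_left)

lemma pact_add_right: "pact P (f + g) = pact P f + pact P g"
  by (induction P) (simp_all add: pact_pCons smult_add_right smul_add_left)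

lemma pact_sum_right: "pact P (sum g A) = (\<Sum>x\<in>A. pact P (g x))"
  by (induction A rule: infinite_finite_induct) (auto simp: pact_add_right)

lemma pact_smult_left: "pact (smult c P) f = smult c (pact P f)"
  by (induction P) (simp_all add: pact_pCons smult_add_right smul_smult_left)

lemma pact_diff_left: "pact (P - Q) f = pact P f - pact Q f"
  using pact_add_left[of P "- Q" f] pact_smult_left[of "- 1" Q f] by simp

text \<open>Scalars act on the left and never meet u; only T acts on the same side, and u commutes
  with \<phi>_T. This is the K[T]-linearity of right multiplication by an endomorphism.\<close>

lemma pact_smul:
  assumes "u \<star> FT = FT \<star> u"
  shows "pact P f \<star> u = pact P (f \<star> u)"
proof (induction P)
  case (pCons c P)
  have "pact P f \<star> FT \<star> u = pact P (f \<star> u) \<star> FT"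
    using assms pCons.IH by (metis smul_assoc)
  thus ?case by (simp add: pact_pCons smul_add_left smul_smult_left)
qed simp

lemma pact_mult: "pact (P * Q) f = pact P (pact Q f)"
proof (induction P)
  case (pCons c P)
  show ?case
    by (simp add: pact_add_left pact_smult_left pact_pCons pCons.IH)
qed simp

text \<open>Constants from F_q are fixed by Frobenius, so they may be moved from the right of f to
  its left.\<close>

lemma pact_map_poly_e: "pact (map_poly e a) f = f \<star> F a"
proof (induction a)
  case (pCons c a)
  have "f \<star> [:e c:] = smult (e c) f"
    by (rule ev_inject) (simp add: ev_mult ev_e_scale)
  thus ?case
    by (simp add: e.map_poly_pCons_hom pact_pCons pCons.IH F_pCons smul_add_right smul_assoc)
qed simp

lemma degree_pact:
  assumes "P \<noteq> 0" "f \<noteq> 0"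
  shows "pact P f \<noteq> 0 \<and> degree (pact P f) = r * degree P + degree f"
  using assms(1)
proof (induction P)
  case (pCons c P)
  show ?case
  proof (cases "P = 0")
    case True
    with pCons.prems assms(2) show ?thesis by (simp add: pact_pCons)
  next
    case False
    hence "pact P f \<noteq> 0" "degree (pact P f) = r * degree P + degree f"
      using pCons.IH by auto
    hence deg: "degree (pact P f \<star> FT) = r * degree P + degree f + r"
      by (simp add: degree_skew_mult FT_nonzero degree_FT)
    have "degree (smult c f) < degree (pact P f \<star> FT)"
      using r_pos degree_smult_le[of c f] deg by linarith
    hence "degree (pact (pCons c P) f) = degree (pact P f \<star> FT)"
      unfolding pact_pCons by (rule degree_add_eq_right)
    with deg False r_pos show ?thesis by auto
  qed
qed simp

section \<open>Weights and coordinates for the basis 1, \<tau>, ..., \<tau>^(r-1)\<close>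

definition lincomb :: "(nat \<Rightarrow> 'k poly) \<Rightarrow> 'k poly" where
  "lincomb P = (\<Sum>j<r. pact (P j) (\<tau> j))"

text \<open>The summand of index j has degree r * degree (P j) + j, which is j modulo r, so no two
  degrees agree and nothing cancels. Both uniqueness of coordinates and the weight bounds on the
  matrix entries come from here.\<close>

lemma lincomb_weights:
  assumes "j0 < r" "P j0 \<noteq> 0"
  shows "lincomb P \<noteq> 0 \<and> (\<exists>j<r. P j \<noteq> 0 \<and> degree (lincomb P) = r * degree (P j) + j) \<and>
    (\<forall>j<r. P j \<noteq> 0 \<longrightarrow> r * degree (P j) + j \<le> degree (lincomb P))"
proof -
  define S where "S = {j. j < r \<and> P j \<noteq> 0}"
  have \<tau>: "\<tau> j \<noteq> 0" "degree (\<tau> j) = j" for j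
    by (simp_all add: degree_monom_eq)
  have eq: "lincomb P = (\<Sum>j\<in>S. pact (P j) (\<tau> j))"
    unfolding lincomb_def S_def by (rule sum.mono_neutral_right) auto
  have deg: "pact (P j) (\<tau> j) \<noteq> 0" "degree (pact (P j) (\<tau> j)) = r * degree (P j) + j" if "j \<in> S" for j
    using degree_pact[of "P j" "\<tau> j"] that \<tau> by (auto simp: S_def)
  have "inj_on (\<lambda>j. degree (pact (P j) (\<tau> j))) S"
  proof (rule inj_onI)
    fix i j assume ij: "i \<in> S" "j \<in> S" "degree (pact (P i) (\<tau> i)) = degree (pact (P j) (\<tau> j))"
    hence "(r * degree (P i) + i) mod r = (r * degree (P j) + j) mod r"
      by (simp add: deg)
    with ij show "i = j" by (simp add: S_def)
  qed
  moreover have "finite S" "S \<noteq> {}" using assms by (auto simp: S_def)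
  ultimately show ?thesis
    unfolding eq using degree_sum_distinct_degrees[of S "\<lambda>j. pact (P j) (\<tau> j)"] deg
    by (auto simp: S_def)
qed

lemma lincomb_diff: "lincomb (\<lambda>j. P j - Q j) = lincomb P - lincomb Q"
  by (simp add: lincomb_def pact_diff_left sum_subtractf)

lemma lincomb_inject:
  assumes "lincomb P = lincomb Q" "j < r"
  shows "P j = Q j"
  using lincomb_weights[of j "\<lambda>j. P j - Q j"] assms by (auto simp: lincomb_diff)

lemma lincomb_surj: "\<exists>P. f = lincomb P"
proof (cases "f = 0")
  case True
  thus ?thesis by (intro exI[of _ "\<lambda>_. 0"]) (simp add: lincomb_def)
next
  case False
  thus ?thesis
  proof (induction "degree f" arbitrary: f rule: less_induct)
    case less
    \<comment> \<open>Dividing deg f by r selects the one product of a power of T with a basis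
      element that has degree deg f; a scalar multiple of it removes the leading term.\<close>
    define j m where "j = degree f mod r" and "m = degree f div r"
    have j: "j < r" using r_pos by (simp add: j_def)
    define h where "h = pact (monom 1 m) (\<tau> j)"
    have h: "degree h = degree f"
      using degree_pact[of "monom 1 m" "\<tau> j"] by (simp_all add: h_def degree_monom_eq j_def m_def)
    moreover have "h \<noteq> 0"
      using degree_pact[of "monom 1 m" "\<tau> j"] by (simp add: h_def)
    ultimately have lc: "coeff h (degree f) \<noteq> 0"
      by (metis leading_coeff_neq_0)
    define c where "c = lead_coeff f / lead_coeff h"
    define g where "g = f - smult c h"
    define P where "P = (\<lambda>i. if i = j then monom c m else 0)"
    have "lincomb P = pact (monom c m) (\<tau> j)"
      using j by (simp add: lincomb_def P_def if_distrib[of "\<lambda>x. pact x _"] cong: if_cong)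
    also have "\<dots> = smult c h"
      by (simp add: h_def smult_monom flip: pact_smult_left)
    finally have f: "f = g + lincomb P" by (simp add: g_def)
    have "\<exists>Q. g = lincomb Q"
    proof (cases "g = 0")
      case True
      thus ?thesis by (intro exI[of _ "\<lambda>_. 0"]) (simp add: lincomb_def)
    next
      case False
      have "degree g < degree f"
      proof (rule degree_lessI)
        show "\<forall>k\<ge>degree f. coeff g k = 0"
        proof (intro allI impI)
          fix k assume "k \<ge> degree f"
          thus "coeff g k = 0"
            using h lc by (cases "k = degree f") (auto simp: g_def c_def coeff_eq_0)
        qed
      qed (use False in simp)
      with less.hyps False show ?thesis by blast
    qed
    then obtain Q where "g = lincomb Q" by blast
    with f have "f = lincomb (\<lambda>i. Q i + P i)"
      by (simp add: lincomb_def pact_add_left sum.distrib)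
    thus ?case by blast
  qed
qed

definition coords :: "'k poly \<Rightarrow> nat \<Rightarrow> 'k poly" where
  "coords f = (SOME P. f = lincomb P)"

lemma lincomb_coords: "lincomb (coords f) = f"
  unfolding coords_def using someI_ex[OF lincomb_surj[of f]] by simp

text \<open>Coordinates are put in rows, so that multiplying by the pairing matrix on the right
  produces the pairings of \<tau>^i u.\<close>

definition motive_mat :: "'k poly \<Rightarrow> 'k poly mat" where
  "motive_mat u = mat r r (\<lambda>(i, j). coords (\<tau> i \<star> u) j)"

lemma motive_mat_carrier [simp]: "motive_mat u \<in> carrier_mat r r"
  by (simp add: motive_mat_def)

lemma motive_mat_row: "i < r \<Longrightarrow> (\<Sum>j<r. pact (motive_mat u $$ (i, j)) (\<tau> j)) = \<tau> i \<star> u"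
  using lincomb_coords[of "\<tau> i \<star> u"] by (simp add: lincomb_def motive_mat_def)

end

section \<open>The determinant on the motive\<close>

text \<open>In the Leibniz expansion every term other than that of \<sigma> is zero or has degree
  below N, so \<open>det A\<close> and the \<sigma> term agree in all coefficients from N
  on.\<close>

lemma degree_det_dominant:
  fixes A :: "'a::idom poly mat"
  assumes A: "A \<in> carrier_mat n n" and \<sigma>: "\<sigma> permutes {0..<n}"
    and nz: "\<And>i. i < n \<Longrightarrow> A $$ (i, \<sigma> i) \<noteq> 0"
    and N: "(\<Sum>i = 0..<n. degree (A $$ (i, \<sigma> i))) = N"
    and less: "\<And>p. p permutes {0..<n} \<Longrightarrow> p \<noteq> \<sigma> \<Longrightarrow> (\<And>i. i < n \<Longrightarrow> A $$ (i, p i) \<noteq> 0) \<Longrightarrow>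
      (\<Sum>i = 0..<n. degree (A $$ (i, p i))) < N"
  shows "det A \<noteq> 0 \<and> degree (det A) = N"
proof -
  define t where "t p = signof p * (\<Prod>i = 0..<n. A $$ (i, p i))" for p
  have det: "det A = (\<Sum>p | p permutes {0..<n}. t p)"
    unfolding t_def by (rule det_def'[OF A])
  have deg: "degree (t p) = degree (\<Prod>i = 0..<n. A $$ (i, p i))" for p
    by (auto simp: t_def sign_def)
  have other: "coeff (t p) k = 0" if "p permutes {0..<n}" "p \<noteq> \<sigma>" "k \<ge> N" for p k
  proof (cases "\<exists>i<n. A $$ (i, p i) = 0")
    case True
    hence "(\<Prod>i = 0..<n. A $$ (i, p i)) = 0" by (intro prod_zero) auto
    thus ?thesis by (simp only: t_def mult_zero_right coeff_0)
  next
    case False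
    have "degree (t p) = (\<Sum>i = 0..<n. degree (A $$ (i, p i)))"
      unfolding deg by (rule degree_prod_eq_sum_degree) (use False in auto)
    also have "\<dots> < N" using less that False by blast
    finally show ?thesis using that by (intro coeff_eq_0) simp
  qed
  have t\<sigma>: "t \<sigma> \<noteq> 0" "degree (t \<sigma>) = N"
    using nz N by (auto simp: t_def sign_def prod_zero_iff degree_prod_eq_sum_degree)
  have coeff: "coeff (det A) k = coeff (t \<sigma>) k" if "k \<ge> N" for k
  proof -
    have "coeff (det A) k = (\<Sum>p\<in>{\<sigma>}. coeff (t p) k)"
      unfolding det coeff_sum
      by (rule sum.mono_neutral_right) (use \<sigma> other that in \<open>auto simp: finite_permutations\<close>)
    thus ?thesis by simp
  qed
  have "coeff (det A) N \<noteq> 0" using coeff[of N] t\<sigma> by auto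
  moreover have "degree (det A) \<le> N"
    by (rule degree_le) (use coeff t\<sigma>(2) in \<open>auto simp: coeff_eq_0\<close>)
  ultimately show ?thesis by (auto intro: antisym le_degree)
qed

context drinfeld_closed
begin

definition mdet :: "'k poly \<Rightarrow> 'k poly" where "mdet u = det (motive_mat u)"

text \<open>With D = degree u, a nonzero entry in row i and column j satisfies r * degree + j \<le>
  i + D, with equality in exactly one column, (i + D) mod r. Summed along a permutation, row and
  column indices cancel; what remains is r * (sum of degrees) \<le> r * D, strict for every
  permutation but \<sigma>.\<close>

lemma mdet_degree:
  assumes "u \<noteq> 0"
  shows "mdet u \<noteq> 0 \<and> degree (mdet u) = degree u"
proof -
  define D where "D = degree u"
  let ?A = "motive_mat u"
  define \<sigma> where "\<sigma> i = (if i < r then (i + D) mod r else i)" for i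
  have inj: "inj_on \<sigma> {0..<r}"
  proof (rule inj_onI)
    fix i j assume ij: "i \<in> {0..<r}" "j \<in> {0..<r}" "\<sigma> i = \<sigma> j"
    hence "[i + D = j + D] (mod r)" by (simp add: \<sigma>_def cong_def)
    hence "[i = j] (mod r)" by (simp add: cong_add_rcancel_nat)
    thus "i = j" using ij by (simp add: cong_def)
  qed
  have "\<sigma> ` {0..<r} = {0..<r}"
    by (rule endo_inj_surj) (use inj in \<open>auto simp: \<sigma>_def\<close>)
  hence \<sigma>: "\<sigma> permutes {0..<r}"
    using inj by (intro bij_imp_permutes) (auto simp: bij_betw_def \<sigma>_def)
  have deg_row: "\<tau> i \<star> u \<noteq> 0" "degree (\<tau> i \<star> u) = i + D" for i
    using assms by (auto simp: degree_skew_mult skew_mult_nonzero degree_monom_eq D_def)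
  have entry: "?A $$ (i, j) = coords (\<tau> i \<star> u) j" if "i < r" "j < r" for i j
    using that by (simp add: motive_mat_def)
  have weights: "(\<forall>j<r. ?A $$ (i, j) \<noteq> 0 \<longrightarrow> r * degree (?A $$ (i, j)) + j \<le> i + D)"
    "\<exists>j<r. ?A $$ (i, j) \<noteq> 0 \<and> r * degree (?A $$ (i, j)) + j = i + D" if i: "i < r" for i
  proof -
    have "\<exists>j<r. coords (\<tau> i \<star> u) j \<noteq> 0"
    proof (rule ccontr)
      assume "\<not> ?thesis"
      hence "lincomb (coords (\<tau> i \<star> u)) = 0" by (simp add: lincomb_def)
      thus False using deg_row(1)[of i] by (simp add: lincomb_coords)
    qed
    then obtain j where "j < r" "coords (\<tau> i \<star> u) j \<noteq> 0" by blast
    from lincomb_weights[of j "coords (\<tau> i \<star> u)", OF this]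
    show "(\<forall>j<r. ?A $$ (i, j) \<noteq> 0 \<longrightarrow> r * degree (?A $$ (i, j)) + j \<le> i + D)"
      "\<exists>j<r. ?A $$ (i, j) \<noteq> 0 \<and> r * degree (?A $$ (i, j)) + j = i + D"
      using i by (auto simp: lincomb_coords deg_row entry)
  qed
  have mod_eq: "j = \<sigma> i" if "i < r" "j < r" "r * d + j = i + D" for i j d
  proof -
    have "(r * d + j) mod r = j" using that(2) by simp
    thus ?thesis using that(1) unfolding that(3) \<sigma>_def by simp
  qed
  have top: "?A $$ (i, \<sigma> i) \<noteq> 0" "r * degree (?A $$ (i, \<sigma> i)) + \<sigma> i = i + D" if "i < r" for i
    using weights(2)[OF that] mod_eq[OF that] by metis+
  have sum_perm: "(\<Sum>i = 0..<r. p i) = (\<Sum>i = 0..<r. i)" if "p permutes {0..<r}" for p :: "nat \<Rightarrow> nat"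
    using sum.permute[OF that, of "\<lambda>i. i"] by (simp add: o_def)
  have total: "(\<Sum>i = 0..<r. i + D) = (\<Sum>i = 0..<r. i) + r * D"
    by (simp add: sum.distrib)
  show ?thesis unfolding mdet_def
  proof (rule degree_det_dominant[OF motive_mat_carrier \<sigma> top(1)])
    have "(\<Sum>i = 0..<r. r * degree (?A $$ (i, \<sigma> i)) + \<sigma> i) = (\<Sum>i = 0..<r. i + D)"
      by (rule sum.cong) (use top in auto)
    hence "r * (\<Sum>i = 0..<r. degree (?A $$ (i, \<sigma> i))) = r * D"
      unfolding total sum.distrib by (simp add: sum_perm[OF \<sigma>] sum_distrib_left)
    thus "(\<Sum>i = 0..<r. degree (?A $$ (i, \<sigma> i))) = degree u"
      using r_pos by (simp add: D_def)
  next
    fix p assume p: "p permutes {0..<r}" "p \<noteq> \<sigma>" and nz: "\<And>i. i < r \<Longrightarrow> ?A $$ (i, p i) \<noteq> 0"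
    have lt: "p i < r" if "i < r" for i
      using permutes_in_image[OF p(1), of i] that by simp
    obtain i0 where i0: "p i0 \<noteq> \<sigma> i0" using p(2) by blast
    have i0r: "i0 < r"
      using i0 p(1) \<sigma> by (metis atLeastLessThan_iff permutes_not_in zero_le)
    have "(\<Sum>i = 0..<r. r * degree (?A $$ (i, p i)) + p i) < (\<Sum>i = 0..<r. i + D)"
    proof (rule sum_strict_mono_ex1)
      show le: "\<forall>i\<in>{0..<r}. r * degree (?A $$ (i, p i)) + p i \<le> i + D"
        using weights(1) nz lt by simp
      have "r * degree (?A $$ (i0, p i0)) + p i0 \<noteq> i0 + D"
        using mod_eq[OF i0r lt[OF i0r]] i0 by blast
      thus "\<exists>i\<in>{0..<r}. r * degree (?A $$ (i, p i)) + p i < i + D"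
        using le i0r by (intro bexI[of _ i0]) (auto simp: le_less)
    qed simp
    hence "r * (\<Sum>i = 0..<r. degree (?A $$ (i, p i))) < r * D"
      unfolding total sum.distrib by (simp add: sum_perm[OF p(1)] sum_distrib_left)
    thus "(\<Sum>i = 0..<r. degree (?A $$ (i, p i))) < degree u"
      using r_pos by (simp add: D_def)
  qed
qed

section \<open>Descent of the determinant to F_q\<close>

definition frob :: "'k poly \<Rightarrow> 'k poly" where "frob = map_poly (\<lambda>x. x ^ CARD('f))"

lemma comm_ring_hom_power_q: "comm_ring_hom (\<lambda>x :: 'k. x ^ CARD('f))"
  by unfold_locales (simp_all add: power_q_add power_mult_distrib)

lemma comm_ring_hom_frob: "comm_ring_hom frob"
proof -
  interpret h: comm_ring_hom "\<lambda>x :: 'k. x ^ CARD('f)" by (rule comm_ring_hom_power_q)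
  interpret map_poly_comm_ring_hom "\<lambda>x :: 'k. x ^ CARD('f)" ..
  show ?thesis unfolding frob_def by unfold_locales
qed

lemma frob_pCons: "frob (pCons c P) = pCons (c ^ CARD('f)) (frob P)"
proof -
  interpret h: comm_ring_hom "\<lambda>x :: 'k. x ^ CARD('f)" by (rule comm_ring_hom_power_q)
  show ?thesis unfolding frob_def by (rule h.map_poly_pCons_hom)
qed

lemma tau_pact: "\<tau> 1 \<star> pact P f = pact (frob P) (\<tau> 1 \<star> f)"
proof (induction P)
  case 0
  thus ?case by (simp add: frob_def)
next
  case (pCons c P)
  have "\<tau> 1 \<star> smult c f = smult (c ^ CARD('f)) (\<tau> 1 \<star> f)"
    by (rule ev_inject) (simp add: ev_mult power_mult_distrib)
  moreover have "\<tau> 1 \<star> (pact P f \<star> FT) = pact (frob P) (\<tau> 1 \<star> f) \<star> FT"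
    by (simp only: pCons.IH flip: smul_assoc)
  ultimately show ?case
    by (simp only: frob_pCons pact_pCons smul_add_right)
qed

text \<open>The element \<tau> \<tau>^i u is expanded in two ways: through \<Phi> and then C, or
  through C and then, pulling \<tau> past the coefficients, through the twist of C and \<Phi>. So
  the twist of C times \<Phi> equals \<Phi> times C, and \<open>det \<Phi>\<close>, of degree 1,
  cancels.\<close>

lemma frob_mdet:
  assumes u: "u \<star> FT = FT \<star> u"
  shows "frob (mdet u) = mdet u"
proof -
  interpret fr: comm_ring_hom frob by (rule comm_ring_hom_frob)
  define C where "C = motive_mat u"
  \<comment> \<open>Although \<tau> need not commute with \<phi>_T, this matrix has a meaning: it
    describes left multiplication by \<tau>, because \<tau> \<tau>^i = \<tau>^i \<tau>.\<close>
  define \<Phi> where "\<Phi> = motive_mat (\<tau> 1)"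
  have C: "C \<in> carrier_mat r r" and \<Phi>: "\<Phi> \<in> carrier_mat r r" and fC: "map_mat frob C \<in> carrier_mat r r"
    by (simp_all add: C_def \<Phi>_def)
  have prod: "lincomb (\<lambda>j. (A * B) $$ (i, j)) = (\<Sum>k<r. pact (A $$ (i, k)) (lincomb (\<lambda>j. B $$ (k, j))))"
    if "A \<in> carrier_mat r r" "B \<in> carrier_mat r r" "i < r" for A B i
  proof -
    have "lincomb (\<lambda>j. (A * B) $$ (i, j)) = (\<Sum>j<r. \<Sum>k<r. pact (A $$ (i, k)) (pact (B $$ (k, j)) (\<tau> j)))"
      unfolding lincomb_def using that
      by (intro sum.cong) (auto simp: scalar_prod_def pact_sum_left pact_mult atLeast0LessThan)
    also have "\<dots> = (\<Sum>k<r. \<Sum>j<r. pact (A $$ (i, k)) (pact (B $$ (k, j)) (\<tau> j)))"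
      by (rule sum.swap)
    finally show ?thesis by (simp add: lincomb_def pact_sum_right)
  qed
  have row: "lincomb (\<lambda>j. motive_mat w $$ (i, j)) = \<tau> i \<star> w" if "i < r" for i w
    using motive_mat_row[OF that] by (simp add: lincomb_def)
  have comm: "\<tau> i \<star> \<tau> 1 = \<tau> 1 \<star> \<tau> i" for i
    by (simp add: smul_monom_monom)
  have "map_mat frob C * \<Phi> = \<Phi> * C"
  proof (rule eq_matI)
    fix i j assume "i < dim_row (\<Phi> * C)" "j < dim_col (\<Phi> * C)"
    hence i: "i < r" and j: "j < r" using C \<Phi> by auto
    have "lincomb (\<lambda>j. (\<Phi> * C) $$ (i, j)) = (\<Sum>k<r. pact (\<Phi> $$ (i, k)) (\<tau> k \<star> u))"
      unfolding prod[OF \<Phi> C i] by (intro sum.cong refl) (simp add: C_def row)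
    also have "\<dots> = (\<Sum>k<r. pact (\<Phi> $$ (i, k)) (\<tau> k)) \<star> u"
      by (simp add: smul_sum_left pact_smul[OF u])
    also have "\<dots> = \<tau> 1 \<star> (\<tau> i \<star> u)"
      unfolding \<Phi>_def motive_mat_row[OF i] by (simp only: comm smul_assoc)
    also have "\<dots> = \<tau> 1 \<star> (\<Sum>k<r. pact (C $$ (i, k)) (\<tau> k))"
      unfolding C_def motive_mat_row[OF i] ..
    also have "\<dots> = (\<Sum>k<r. pact (frob (C $$ (i, k))) (\<tau> k \<star> \<tau> 1))"
      by (simp add: smul_sum_right tau_pact comm del: One_nat_def)
    also have "\<dots> = lincomb (\<lambda>j. (map_mat frob C * \<Phi>) $$ (i, j))"
      unfolding prod[OF fC \<Phi> i]
      by (intro sum.cong refl) (use C i in \<open>simp add: \<Phi>_def row\<close>)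
    finally show "(map_mat frob C * \<Phi>) $$ (i, j) = (\<Phi> * C) $$ (i, j)"
      using lincomb_inject j by metis
  qed (use C \<Phi> in auto)
  hence "det (map_mat frob C) * det \<Phi> = det \<Phi> * det C"
    by (metis det_mult C \<Phi> fC)
  moreover have "det \<Phi> \<noteq> 0"
    using mdet_degree[of "\<tau> 1"] by (simp add: mdet_def \<Phi>_def)
  ultimately show ?thesis
    by (simp add: mdet_def C_def fr.hom_det mult.commute)
qed

text \<open>X^q - X has at most q roots, and \<open>range e\<close> already supplies q of
  them.\<close>

lemma fixed_by_frobenius:
  assumes "x ^ CARD('f) = x"
  shows "x \<in> range e"
proof -
  let ?P = "monom 1 CARD('f) - [:0, 1:] :: 'k poly"
  have "coeff ?P CARD('f) = 1"
    using q_gt_1 by (simp add: coeff_eq_0)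
  hence P: "?P \<noteq> 0" by (metis coeff_0 zero_neq_one)
  have deg: "degree ?P \<le> CARD('f)"
    using q_gt_1 by (intro degree_diff_le) (auto simp: degree_monom_eq)
  have "range e \<subseteq> {x. poly ?P x = 0}"
    by (auto simp: poly_monom)
  moreover have "card {x. poly ?P x = 0} \<le> card (range e)"
    using card_poly_roots_bound[OF P] deg by (simp add: card_image e.inj_f)
  ultimately have "range e = {x. poly ?P x = 0}"
    using poly_roots_finite[OF P] by (intro card_seteq) auto
  thus ?thesis using assms by (simp add: poly_monom)
qed

lemma mdet_descends:
  assumes "u \<star> FT = FT \<star> u"
  obtains d where "map_poly e d = mdet u"
proof -
  have "coeff (mdet u) n \<in> range e" for n
  proof (rule fixed_by_frobenius)
    have "coeff (frob (mdet u)) n = coeff (mdet u) n ^ CARD('f)"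
      by (simp add: frob_def coeff_map_poly q_gt_1 power_0_left)
    thus "coeff (mdet u) n ^ CARD('f) = coeff (mdet u) n"
      by (simp add: frob_mdet[OF assms])
  qed
  hence inv: "e (inv_into UNIV e (coeff (mdet u) n)) = coeff (mdet u) n" for n
    by (simp add: f_inv_into_f)
  have "inv_into UNIV e 0 = 0" by (metis e.hom_zero e.inj_f inv_f_f)
  hence "map_poly e (map_poly (inv_into UNIV e) (mdet u)) = mdet u"
    by (intro poly_eqI) (simp add: coeff_map_poly inv)
  thus ?thesis by (rule that)
qed

end

section \<open>The determinant on torsion points\<close>

text \<open>A root of P is not a root of Q, hence is one of R; its linear factor is removed from P
  and R, and the degree of P drops.\<close>

lemma dvd_cancel_no_common_root:
  fixes P Q R :: "'k::alg_closed_field poly"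
  assumes "P \<noteq> 0" and no_root: "\<And>\<theta>. poly P \<theta> = 0 \<Longrightarrow> poly Q \<theta> \<noteq> 0"
    and "P dvd Q * R"
  shows "P dvd R"
  using assms
proof (induction "degree P" arbitrary: P R rule: less_induct)
  case less
  show ?case
  proof (cases "degree P = 0")
    case True
    then obtain c where "P = [:c:]" by (rule degree_eq_zeroE)
    thus ?thesis using less.prems(1) by (auto intro: dvd_trans[of _ 1] simp: is_unit_iff_degree)
  next
    case False
    then obtain \<theta> where \<theta>: "poly P \<theta> = 0"
      using alg_closed_imp_poly_has_root by blast
    then obtain P' where P': "P = [:- \<theta>, 1:] * P'"
      by (auto simp: poly_eq_0_iff_dvd elim: dvdE)
    have "poly (Q * R) \<theta> = 0"
      using less.prems(3) \<theta> by (meson dvd_trans poly_eq_0_iff_dvd)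
    hence "poly R \<theta> = 0"
      using less.prems(2)[OF \<theta>] by simp
    then obtain R' where R': "R = [:- \<theta>, 1:] * R'"
      by (auto simp: poly_eq_0_iff_dvd elim: dvdE)
    have "P' \<noteq> 0" using less.prems(1) P' by auto
    have "degree P = Suc (degree P')"
      unfolding P' using \<open>P' \<noteq> 0\<close> by (subst degree_mult_eq) auto
    moreover have "[:- \<theta>, 1:] * P' dvd [:- \<theta>, 1:] * (Q * R')"
      using less.prems(3) unfolding P' R' by (simp only: mult.left_commute)
    hence "P' dvd Q * R'"
      by (subst (asm) dvd_mult_cancel_left) simp
    moreover have "poly P' x = 0 \<Longrightarrow> poly Q x \<noteq> 0" for x
      using less.prems(2)[of x] by (simp add: P')
    ultimately have "P' dvd R'"
      using less.hyps[of P' R'] \<open>P' \<noteq> 0\<close> by simp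
    thus ?thesis unfolding P' R' by (rule mult_dvd_mono[OF dvd_refl])
  qed
qed

text \<open>Division with remainder survives field extension: the image of the remainder keeps a
  degree too small for a nonzero multiple of the image of a.\<close>

lemma dvd_map_poly_field_hom:
  assumes "field_hom e" "map_poly e a dvd map_poly e b"
  shows "a dvd b"
proof (cases "a = 0")
  case False
  interpret e: field_hom e by fact
  interpret ep: map_poly_inj_idom_hom e ..
  let ?m = "map_poly e"
  have "b = a * (b div a) + b mod a" by simp
  hence eq: "?m b = ?m a * ?m (b div a) + ?m (b mod a)"
    by (metis ep.hom_add ep.hom_mult)
  have "?m a dvd ?m (b mod a)"
    using assms(2) unfolding eq by (simp add: dvd_add_right_iff)
  hence "b mod a = 0 \<or> degree a \<le> degree (b mod a)"
    by (metis dvd_imp_degree_le ep.hom_0_iff e.degree_map_poly_hom)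
  with degree_mod_less[OF False, of b] show ?thesis
    by (auto simp: dvd_eq_mod_eq_0)
next
  case True
  interpret e: field_hom e by fact
  interpret ep: map_poly_inj_idom_hom e ..
  show ?thesis using assms(2) True by simp
qed

lemma det_cong:
  fixes A B :: "'a::{field} poly mat"
  assumes "A \<in> carrier_mat n n" "B \<in> carrier_mat n n"
    and "\<And>i j. i < n \<Longrightarrow> j < n \<Longrightarrow> [A $$ (i, j) = B $$ (i, j)] (mod m)"
  shows "[det A = det B] (mod m)"
  unfolding det_def'[OF assms(1)] det_def'[OF assms(2)]
proof (intro cong_sum cong_mult cong_refl cong_prod assms(3))
qed (auto simp: permutes_in_image)

context drinfeld_closed
begin

text \<open>The coefficients of \<open>gen a f z\<close> are those of the Anderson generating function
  \<open>\<Sum>n. f (\<phi>\<^bsub>T^n\<^esub> z) T\<^bsup>-n-1\<^esup>\<close> multiplied by \<open>a\<close>; for an \<open>a\<close>-torsion point \<open>z\<close> this product is a polynomial.\<close>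

definition gen :: "'f poly \<Rightarrow> 'k poly \<Rightarrow> 'k \<Rightarrow> 'k poly" where
  "gen a f z = (\<Sum>n<degree a. monom (ev f (act (poly_shift (Suc n) a) z)) n)"

lemma coeff_gen: "coeff (gen a f z) n = ev f (act (poly_shift (Suc n) a) z)"
proof (cases "n < degree a")
  case True
  have "coeff (gen a f z) n =
      (\<Sum>m<degree a. if m = n then ev f (act (poly_shift (Suc n) a) z) else 0)"
    unfolding gen_def coeff_sum coeff_monom by (intro sum.cong) auto
  with True show ?thesis by simp
next
  case False
  hence "poly_shift (Suc n) a = 0"
    by (intro poly_eqI) (simp add: coeff_poly_shift coeff_eq_0)
  with False show ?thesis by (simp add: gen_def coeff_sum)
qed

lemma degree_gen: "a \<noteq> 0 \<Longrightarrow> degree a > 0 \<Longrightarrow> degree (gen a f z) < degree a"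
  unfolding gen_def by (intro degree_sum_less le_less_trans[OF degree_monom_le]) auto

lemma gen_sum_left: "gen a (sum g A) z = (\<Sum>x\<in>A. gen a (g x) z)"
  by (intro poly_eqI) (simp add: coeff_gen coeff_sum skew_ev_sum)

lemma gen_add_left: "gen a (f + g) z = gen a f z + gen a g z"
  by (intro poly_eqI) (simp add: coeff_gen skew_ev_add)

lemma gen_smult: "gen a (smult c f) z = smult c (gen a f z)"
  by (intro poly_eqI) (simp add: coeff_gen)

lemma gen_sum_right: "gen a f (sum g A) = (\<Sum>x\<in>A. gen a f (g x))"
  by (intro poly_eqI) (simp add: coeff_gen coeff_sum act_sum_right ev_arg_sum)

text \<open>Adjointness of the pairing: u on the right of f becomes u applied to the point, once it
  is moved past the action of F_q[T].\<close>

lemma gen_smul: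
  assumes "\<And>a. u \<star> F a = F a \<star> u"
  shows "gen a (f \<star> u) z = gen a f (ev u z)"
  by (intro poly_eqI) (simp add: coeff_gen ev_mult act_def flip: assms, simp add: assms flip: ev_mult)

text \<open>\<open>poly_shift n a\<close> is the n-th coefficient of a plus T times
  \<open>poly_shift (Suc n) a\<close>, so \<phi>_T moves the coefficients of the pairing by one
  place, and the corrections assemble into a multiple of a.\<close>

lemma gen_FT:
  assumes "z \<in> tors a"
  shows "gen a (f \<star> FT) z = pCons 0 (gen a f z) - smult (ev f z) (map_poly e a)"
proof (rule poly_eqI)
  fix n
  have "poly_shift n a = [:coeff a n:] + [:0, 1:] * poly_shift (Suc n) a"
    by (intro poly_eqI) (simp add: coeff_poly_shift coeff_pCons split: nat.splits)
  hence "act (poly_shift n a) z = act ([:coeff a n:] + [:0, 1:] * poly_shift (Suc n) a) z"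
    by (rule arg_cong)
  hence "act (poly_shift n a) z = e (coeff a n) * z + ev FT (act (poly_shift (Suc n) a) z)"
    unfolding act_add_left act_mult act_const act_def[of "[:0, 1:]"] FT_def .
  hence "ev (f \<star> FT) (act (poly_shift (Suc n) a) z) = ev f (act (poly_shift n a) z - e (coeff a n) * z)"
    by (simp add: ev_mult)
  hence *: "coeff (gen a (f \<star> FT) z) n = ev f (act (poly_shift n a) z) - e (coeff a n) * ev f z"
    by (simp add: coeff_gen ev_arg_diff ev_e_scale)
  show "coeff (gen a (f \<star> FT) z) n = coeff (pCons 0 (gen a f z) - smult (ev f z) (map_poly e a)) n"
    \<comment> \<open>Torsion enters at n = 0: there the shift is a itself, and it kills z.\<close>
    unfolding * using assms
    by (simp add: coeff_pCons coeff_gen coeff_map_poly tors_def split: nat.splits)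
qed

lemma gen_pact:
  assumes "z \<in> tors a"
  shows "[gen a (pact P f) z = P * gen a f z] (mod map_poly e a)"
proof (induction P)
  case 0
  have "gen a 0 z = 0" by (intro poly_eqI) (simp add: coeff_gen)
  thus ?case by simp
next
  case (pCons c P)
  let ?a = "map_poly e a"
  have "[gen a (pact P f \<star> FT) z = pCons 0 (gen a (pact P f) z)] (mod ?a)"
    unfolding gen_FT[OF assms] cong_iff_dvd_diff by (simp add: dvd_smult)
  also have "pCons 0 (gen a (pact P f) z) = [:0, 1:] * gen a (pact P f) z" by simp
  also have "[[:0, 1:] * gen a (pact P f) z = [:0, 1:] * (P * gen a f z)] (mod ?a)"
    by (intro cong_mult cong_refl pCons.IH)
  finally have "[smult c (gen a f z) + gen a (pact P f \<star> FT) z =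
      smult c (gen a f z) + [:0, 1:] * (P * gen a f z)] (mod ?a)"
    by (intro cong_add cong_refl)
  thus ?case by (simp add: pact_pCons gen_add_left gen_smult)
qed

text \<open>Acting by c on the point is right multiplication by \<phi>_c on the skew polynomial,
  which is the action of c on the motive.\<close>

lemma gen_act:
  assumes "z \<in> tors a"
  shows "[gen a f (act c z) = map_poly e c * gen a f z] (mod map_poly e a)"
proof -
  have "gen a (f \<star> F c) z = gen a f (act c z)"
    unfolding act_def by (rule gen_smul) (rule F_commute)
  thus ?thesis using gen_pact[OF assms, of "map_poly e c" f] by (simp add: pact_map_poly_e)
qed

text \<open>A common root \<open>\<theta>\<close> of \<open>a\<close> and the determinant would give a nonzero skew polynomial of degree
  less than \<open>r deg a\<close> killing all of the \<open>q\<^bsup>r deg a\<^esup>\<close> torsion points.\<close>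

lemma gen_det_nonzero:
  assumes a: "poly (map_poly e a) (coeff FT 0) \<noteq> 0"
    and b: "\<And>s. s < r \<Longrightarrow> b s \<in> tors a"
    and gen: "\<And>z. z \<in> tors a \<Longrightarrow> \<exists>c. z = (\<Sum>s<r. act (c s) (b s))"
    and root: "poly (map_poly e a) \<theta> = 0"
  shows "poly (det (mat r r (\<lambda>(i, s). gen a (\<tau> i) (b s)))) \<theta> \<noteq> 0"
proof
  let ?a = "map_poly e a"
  let ?\<Psi> = "mat r r (\<lambda>(i, s). gen a (\<tau> i) (b s))"
  assume det0: "poly (det ?\<Psi>) \<theta> = 0"
  have a0: "a \<noteq> 0" using a by auto
  have dega: "degree a > 0"
  proof (rule ccontr)
    assume "\<not> degree a > 0"
    then obtain c where "a = [:c:]" by (metis degree_eq_zeroE gr0I)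
    with root a0 show False by simp
  qed
  have hom: "comm_ring_hom (\<lambda>p. poly p \<theta>)" by unfold_locales auto
  let ?\<Psi>\<theta> = "map_mat (\<lambda>p. poly p \<theta>) ?\<Psi>"
  have carr: "transpose_mat ?\<Psi>\<theta> \<in> carrier_mat r r" by simp
  have "det ?\<Psi>\<theta> = 0" using det0 by (simp add: comm_ring_hom.hom_det[OF hom])
  hence "det (transpose_mat ?\<Psi>\<theta>) = 0"
    by (subst det_transpose[of _ r]) auto
  \<comment> \<open>A kernel vector at \<theta>, read as a list of coefficients, is a skew
    polynomial of degree below r whose pairings with all generators vanish at \<theta>.\<close>
  then obtain v where v: "v \<in> carrier_vec r" "v \<noteq> 0\<^sub>v r" "transpose_mat ?\<Psi>\<theta> *\<^sub>v v = 0\<^sub>v r"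
    using det_0_iff_vec_prod_zero_field[OF carr] by blast
  define f where "f = (\<Sum>i<r. monom (v $ i) i)"
  have coeff_f: "coeff f i = v $ i" if "i < r" for i
    using that by (simp add: f_def coeff_sum)
  obtain i0 where i0: "i0 < r" "v $ i0 \<noteq> 0"
    using v(1,2) by (metis eq_vecI index_zero_vec(1) index_zero_vec(2) carrier_vecD)
  have f0: "f \<noteq> 0" using coeff_f[OF i0(1)] i0(2) by auto
  have degf: "degree f < r"
    unfolding f_def by (rule degree_sum_less) (use r_pos in \<open>auto intro: le_less_trans[OF degree_monom_le]\<close>)
  have gen_b: "poly (gen a f (b s)) \<theta> = 0" if s: "s < r" for s
  proof -
    have "f = (\<Sum>i<r. smult (v $ i) (\<tau> i))" by (simp add: f_def smult_monom)
    hence "poly (gen a f (b s)) \<theta> = (\<Sum>i<r. v $ i * poly (gen a (\<tau> i) (b s)) \<theta>)"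
      by (simp add: gen_sum_left gen_smult poly_sum)
    also have "\<dots> = (transpose_mat ?\<Psi>\<theta> *\<^sub>v v) $ s"
      using s v(1) by (simp add: scalar_prod_def atLeast0LessThan mult.commute)
    also have "\<dots> = 0" using v(3) s by simp
    finally show ?thesis .
  qed
  have gen_z: "poly (gen a f z) \<theta> = 0" if z: "z \<in> tors a" for z
  proof -
    obtain c where c: "z = (\<Sum>s<r. act (c s) (b s))" using gen[OF z] by blast
    have "poly (gen a f (act (c s) (b s))) \<theta> = 0" if "s < r" for s
    proof -
      have "?a dvd gen a f (act (c s) (b s)) - map_poly e (c s) * gen a f (b s)"
        using gen_act[OF b[OF that], of f "c s"] by (simp add: cong_iff_dvd_diff)
      hence "poly (gen a f (act (c s) (b s)) - map_poly e (c s) * gen a f (b s)) \<theta> = 0"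
        using root by (meson dvd_trans poly_eq_0_iff_dvd)
      thus ?thesis using gen_b[OF that] by simp
    qed
    thus ?thesis by (simp add: c gen_sum_right poly_sum)
  qed
  \<comment> \<open>h is a / (T - \<theta>). Multiplication by h turns vanishing at \<theta> into
    divisibility by a, and a pairing of degree below deg a is then zero.\<close>
  obtain h where h: "?a = [:- \<theta>, 1:] * h"
    using root by (auto simp: poly_eq_0_iff_dvd elim: dvdE)
  have h0: "h \<noteq> 0" using h a0 by auto
  have degh: "degree a = Suc (degree h)"
    using h h0 by (metis e.degree_map_poly_hom degree_mult_eq degree_pCons_eq_if one_neq_zero
      pCons_eq_0_iff plus_1_eq_Suc One_nat_def degree_1 one_pCons)
  have "ev (pact h f) z = 0" if z: "z \<in> tors a" for z
  proof -
    obtain g where "gen a f z = [:- \<theta>, 1:] * g"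
      using gen_z[OF z] by (auto simp: poly_eq_0_iff_dvd elim: dvdE)
    hence "?a dvd h * gen a f z"
      unfolding h by (simp only: mult_ac) simp
    hence "?a dvd gen a (pact h f) z"
      using gen_pact[OF z, of h f] by (metis cong_0_iff cong_trans)
    hence "gen a (pact h f) z = 0"
      using degree_gen[OF a0 dega, of "pact h f" z]
      by (metis dvd_imp_degree_le e.degree_map_poly_hom not_le)
    \<comment> \<open>In the top coefficient, of index deg a - 1, the shift of a is just its leading
      coefficient, so the value at z itself is recovered up to a nonzero scalar.\<close>
    hence "ev (pact h f) (act (poly_shift (degree a) a) z) = 0"
      using coeff_gen[of a "pact h f" z "degree a - 1"] dega by simp
    moreover have "poly_shift (degree a) a = [:lead_coeff a:]"
      by (intro poly_eqI) (simp add: coeff_poly_shift coeff_pCons coeff_eq_0 split: nat.splits)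
    ultimately show ?thesis using a0 by (simp add: act_const ev_e_scale)
  qed
  hence sub: "tors a \<subseteq> {z. ev (pact h f) z = 0}" by blast
  have ph: "pact h f \<noteq> 0" "degree (pact h f) = r * degree h + degree f"
    using degree_pact[OF h0 f0] by auto
  have "CARD('f) ^ (r * degree a) = card (tors a)"
    by (rule card_tors[OF a, symmetric])
  also have "\<dots> \<le> card {z. ev (pact h f) z = 0}"
    by (rule card_mono[OF roots_ev(1)[OF ph(1)] sub])
  also have "\<dots> \<le> CARD('f) ^ (r * degree h + degree f)"
    using roots_ev(2)[OF ph(1)] by (simp only: ph(2))
  finally have "r * degree a \<le> r * degree h + degree f"
    by (rule power_le_imp_le_exp[OF q_gt_1])
  thus False using degf degh by simp
qed

text \<open>The pairing matrix intertwines the two actions of u: C \<Psi> and \<Psi> U both give the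
  pairings of \<tau>^i u with the generators modulo a. In the determinants the common factor
  \<open>det ?\<Psi>\<close> has no root in common with a and cancels; the remaining divisibility is
  pulled back to F_q[T].\<close>

lemma det_torsion:
  assumes a: "poly (map_poly e a) (coeff FT 0) \<noteq> 0"
    and b: "\<And>s. s < r \<Longrightarrow> b s \<in> tors a"
    and gen: "\<And>z. z \<in> tors a \<Longrightarrow> \<exists>c. z = (\<Sum>s<r. act (c s) (b s))"
    and u: "\<And>a. u \<star> F a = F a \<star> u"
    and U: "U \<in> carrier_mat r r" "\<And>s. s < r \<Longrightarrow> ev u (b s) = (\<Sum>t<r. act (U $$ (t, s)) (b t))"
    and d: "map_poly e d = mdet u"
  shows "[det U = d] (mod a)"
proof -
  let ?a = "map_poly e a"
  let ?\<Psi> = "mat r r (\<lambda>(i, s). gen a (\<tau> i) (b s))"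
  let ?C = "motive_mat u"
  let ?U = "map_mat (map_poly e) U"
  have a0: "?a \<noteq> 0" using a by auto
  have \<Psi>: "?\<Psi> \<in> carrier_mat r r" and C: "?C \<in> carrier_mat r r" and eU: "?U \<in> carrier_mat r r"
    using U by simp_all
  have "[det (?C * ?\<Psi>) = det (?\<Psi> * ?U)] (mod ?a)"
  proof (rule det_cong)
    fix i s assume i: "i < r" and s: "s < r"
    have "(?C * ?\<Psi>) $$ (i, s) = (\<Sum>j<r. ?C $$ (i, j) * gen a (\<tau> j) (b s))"
      using i s carrier_matD[OF C] by (simp add: scalar_prod_def atLeast0LessThan)
    also have "[\<dots> = (\<Sum>j<r. gen a (pact (?C $$ (i, j)) (\<tau> j)) (b s))] (mod ?a)"
      by (intro cong_sum cong_sym[OF gen_pact] b s)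
    also have "(\<Sum>j<r. gen a (pact (?C $$ (i, j)) (\<tau> j)) (b s)) = gen a (\<tau> i \<star> u) (b s)"
      by (simp add: motive_mat_row[OF i] flip: gen_sum_left)
    also have "\<dots> = gen a (\<tau> i) (ev u (b s))"
      by (rule gen_smul[OF u])
    also have "\<dots> = (\<Sum>t<r. gen a (\<tau> i) (act (U $$ (t, s)) (b t)))"
      by (simp add: U(2)[OF s] gen_sum_right)
    also have "[\<dots> = (\<Sum>t<r. map_poly e (U $$ (t, s)) * gen a (\<tau> i) (b t))] (mod ?a)"
      by (intro cong_sum gen_act b) simp
    also have "(\<Sum>t<r. map_poly e (U $$ (t, s)) * gen a (\<tau> i) (b t)) = (?\<Psi> * ?U) $$ (i, s)"
      using i s U(1) by (simp add: scalar_prod_def atLeast0LessThan mult.commute)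
    finally show "[(?C * ?\<Psi>) $$ (i, s) = (?\<Psi> * ?U) $$ (i, s)] (mod ?a)" .
  qed (rule mult_carrier_mat[OF C \<Psi>] mult_carrier_mat[OF \<Psi> eU])+
  moreover have "det (?C * ?\<Psi>) = det ?\<Psi> * map_poly e d"
    by (simp add: det_mult[OF C \<Psi>] d mdet_def)
  moreover have "det (?\<Psi> * ?U) = det ?\<Psi> * map_poly e (det U)"
    by (simp add: det_mult[OF \<Psi> eU] ep.hom_det)
  ultimately have "?a dvd det ?\<Psi> * map_poly e (d - det U)"
    by (simp add: cong_iff_dvd_diff ep.hom_minus right_diff_distrib)
  hence "?a dvd map_poly e (d - det U)"
    using dvd_cancel_no_common_root[OF a0] gen_det_nonzero[OF a b gen] by blast
  hence "a dvd d - det U"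
    by (rule dvd_map_poly_field_hom[OF e.field_hom_axioms])
  hence "[d = det U] (mod a)" by (simp add: cong_iff_dvd_diff)
  thus ?thesis by (rule cong_sym)
qed

end

section \<open>Bases of Tate modules\<close>

text \<open>Vanishing coefficients replace a bound on the degree: for n = 0 only the zero polynomial
  is left, as a modulus of degree 0 requires.\<close>

lemma card_polys_degree_less:
  "card {p :: 'f::{zero,finite} poly. \<forall>i\<ge>n. coeff p i = 0} = CARD('f) ^ n \<and>
   finite {p :: 'f poly. \<forall>i\<ge>n. coeff p i = 0}"
proof (induction n)
  case 0
  have "{p :: 'f poly. \<forall>i\<ge>0. coeff p i = 0} = {0}" by (auto simp: poly_eq_iff)
  thus ?case by simp
next
  case (Suc n)
  let ?S = "\<lambda>n. {p :: 'f poly. \<forall>i\<ge>n. coeff p i = 0}"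
  have "?S (Suc n) = (\<lambda>(c, p). pCons c p) ` (UNIV \<times> ?S n)"
  proof (intro equalityI subsetI)
    fix p assume p: "p \<in> ?S (Suc n)"
    obtain c p' where "p = pCons c p'" by (cases p)
    moreover from this p have "p' \<in> ?S n" by (auto simp: coeff_pCons split: nat.splits)
    ultimately show "p \<in> (\<lambda>(c, p). pCons c p) ` (UNIV \<times> ?S n)" by auto
  qed (auto simp: coeff_pCons split: nat.splits)
  moreover have "inj_on (\<lambda>(c, p). pCons c p) (UNIV \<times> ?S n)"
    by (auto simp: inj_on_def)
  ultimately show ?case
    using Suc.IH by (simp add: card_image card_cartesian_product)
qed

lemma mod_eq_self_iff_coeff:
  fixes p a :: "'f::field poly"
  assumes "a \<noteq> 0"
  shows "p mod a = p \<longleftrightarrow> (\<forall>i\<ge>degree a. coeff p i = 0)"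
proof
  assume "p mod a = p"
  thus "\<forall>i\<ge>degree a. coeff p i = 0"
    using degree_mod_less[OF assms, of p] by (auto intro: coeff_eq_0)
next
  assume *: "\<forall>i\<ge>degree a. coeff p i = 0"
  show "p mod a = p"
  proof (cases "p = 0")
    case False
    hence "degree p < degree a" using * by (metis leading_coeff_0_iff not_le)
    thus ?thesis by (rule mod_poly_less)
  qed simp
qed

lemma card_reduced_polys:
  fixes a :: "'f::finite_field poly"
  assumes "a \<noteq> 0"
  shows "card {p. p mod a = p} = CARD('f) ^ degree a" "finite {p. p mod a = p}"
  using card_polys_degree_less[of "degree a", where 'f = 'f]
  by (simp_all add: mod_eq_self_iff_coeff[OF assms])

text \<open>Multiplication by c is injective on the finite set of residues because l is prime, hence
  it reaches 1.\<close>

lemma inverse_mod_irreducible: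
  fixes l :: "'f::finite_field poly"
  assumes "Factorial_Ring.irreducible l" "\<not> l dvd c"
  obtains s where "l dvd s * c - 1"
proof -
  have l: "l \<noteq> 0" using assms(1) by auto
  have prime: "prime_elem l" by (rule field_poly_irreducible_imp_prime[OF assms(1)])
  let ?R = "{p. p mod l = p}"
  have "inj_on (\<lambda>s. (s * c) mod l) ?R"
  proof (rule inj_onI)
    fix s t assume st: "s \<in> ?R" "t \<in> ?R" "(s * c) mod l = (t * c) mod l"
    hence "l dvd (s - t) * c" by (simp add: mod_eq_dvd_iff left_diff_distrib)
    hence "l dvd s - t" using prime assms(2) prime_elem_dvd_mult_iff by blast
    hence "s mod l = t mod l" by (simp add: mod_eq_dvd_iff)
    with st show "s = t" by simp
  qed
  hence "(\<lambda>s. (s * c) mod l) ` ?R = ?R"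
    by (intro endo_inj_surj card_reduced_polys(2)[OF l]) auto
  moreover have "1 mod l \<in> ?R" by simp
  ultimately obtain s where "1 mod l = (s * c) mod l" by blast
  hence "l dvd s * c - 1" by (metis mod_eq_dvd_iff)
  thus ?thesis by (rule that)
qed

text \<open>l(g_0) is the \<tau>^0 coefficient of \<phi>_l; being nonzero, it gives the l^m-torsion
  its full size for every m.\<close>

locale drinfeld_prime = drinfeld_closed e r F
  for e :: "'f::finite_field \<Rightarrow> 'k::alg_closed_field" and r F +
  fixes l :: "'f poly"
  assumes irreducible_l: "Factorial_Ring.irreducible l"
    and l_not_char: "poly (map_poly e l) (coeff FT 0) \<noteq> 0"
begin

lemma l_nonzero [simp]: "l \<noteq> 0"
  using irreducible_l by auto

lemma degree_l_pos: "degree l > 0"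
  using irreducible_l l_nonzero by (metis gr0I is_unit_iff_degree irreducible_not_unit)

lemma power_l_not_char: "poly (map_poly e (l ^ m)) (coeff FT 0) \<noteq> 0"
  using l_not_char by (simp add: ep.hom_power)

definition reduced :: "nat \<Rightarrow> 'f poly set" where "reduced m = {p. p mod l ^ m = p}"

lemma degree_power_l: "degree (l ^ m) = m * degree l"
  by (simp add: degree_power_eq)

lemma card_reduced: "card (reduced m) = CARD('f) ^ (m * degree l)" and finite_reduced: "finite (reduced m)"
  using card_reduced_polys[of "l ^ m"] by (simp_all add: reduced_def degree_power_l)

lemma card_tors_l: "card (tors (l ^ m)) = CARD('f) ^ (r * (m * degree l))"
  using card_tors[OF power_l_not_char[of m]] by (simp add: degree_power_l)

lemma act_tors: "z \<in> tors a \<Longrightarrow> act c z \<in> tors a"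
  by (simp add: tors_def act_commute[of a c])

lemma sum_tors: "(\<And>x. x \<in> A \<Longrightarrow> g x \<in> tors a) \<Longrightarrow> sum g A \<in> tors a"
  by (simp add: tors_def act_sum_right)

lemma act_dvd_tors: "a dvd c \<Longrightarrow> z \<in> tors a \<Longrightarrow> act c z = 0"
  by (auto simp: tors_def act_mult mult.commute elim!: dvdE)

lemma act_mod_tors:
  assumes "z \<in> tors a"
  shows "act (c mod a) z = act c z"
proof -
  have "act c z - act (c mod a) z = act (c - c mod a) z" by (simp add: act_diff_left)
  also have "\<dots> = 0" by (rule act_dvd_tors[OF _ assms]) simp
  finally show ?thesis by simp
qed

text \<open>For l^m-torsion points this is freeness over F_q[T]/(l^m). The coefficients are
  arbitrary polynomials, so that relations can be divided by l.\<close>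

definition independent :: "nat \<Rightarrow> nat \<Rightarrow> (nat \<Rightarrow> 'k) \<Rightarrow> bool" where
  "independent m n b \<longleftrightarrow> (\<forall>c. (\<Sum>i<n. act (c i) (b i)) = 0 \<longrightarrow> (\<forall>i<n. l ^ m dvd c i))"

lemma independent_inj:
  assumes "independent m n b"
  shows "inj_on (\<lambda>c. \<Sum>i<n. act (c i) (b i)) ({..<n} \<rightarrow>\<^sub>E reduced m)"
proof (rule inj_onI)
  fix c c' assume c: "c \<in> {..<n} \<rightarrow>\<^sub>E reduced m" and c': "c' \<in> {..<n} \<rightarrow>\<^sub>E reduced m"
    and eq: "(\<Sum>i<n. act (c i) (b i)) = (\<Sum>i<n. act (c' i) (b i))"
  hence "(\<Sum>i<n. act (c i - c' i) (b i)) = 0"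
    by (simp add: act_diff_left sum_subtractf)
  hence "l ^ m dvd c i - c' i" if "i < n" for i
    using assms that by (auto simp: independent_def)
  hence "c i mod l ^ m = c' i mod l ^ m" if "i < n" for i
    using that by (simp add: mod_eq_dvd_iff)
  hence "c i = c' i" if "i < n" for i
    using that PiE_mem[OF c, of i] PiE_mem[OF c', of i] by (simp add: reduced_def)
  thus "c = c'" by (intro PiE_ext[OF c c']) auto
qed

lemma card_coeffs: "card ({..<n} \<rightarrow>\<^sub>E reduced m) = CARD('f) ^ (n * (m * degree l))"
  by (simp add: card_PiE card_reduced mult.commute flip: power_mult)

text \<open>Independence gives injectivity; both sides have q^(r m deg l) elements.\<close>

lemma independent_bij:
  assumes "independent m r b" "\<And>i. i < r \<Longrightarrow> b i \<in> tors (l ^ m)"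
  shows "bij_betw (\<lambda>c. \<Sum>i<r. act (c i) (b i)) ({..<r} \<rightarrow>\<^sub>E reduced m) (tors (l ^ m))"
proof -
  let ?f = "\<lambda>c. \<Sum>i<r. act (c i) (b i)" and ?X = "{..<r} \<rightarrow>\<^sub>E reduced m"
  have "?f ` ?X \<subseteq> tors (l ^ m)"
    using assms(2) by (auto intro!: sum_tors act_tors)
  moreover have "card (?f ` ?X) = card (tors (l ^ m))"
    by (simp add: card_image[OF independent_inj[OF assms(1)]] card_coeffs card_tors_l)
  ultimately have "?f ` ?X = tors (l ^ m)"
    by (intro card_subset_eq finite_tors) auto
  thus ?thesis using independent_inj[OF assms(1)] by (simp add: bij_betw_def)
qed

text \<open>Greedy choice: n < r independent points span q^(n deg l) of the q^(r deg l) torsion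
  points, which leaves a point outside the span.\<close>

lemma exists_independent:
  assumes "n \<le> r"
  shows "\<exists>b. (\<forall>i<n. b i \<in> tors l) \<and> independent 1 n b"
  using assms
proof (induction n)
  case (Suc n)
  then obtain b where b: "\<And>i. i < n \<Longrightarrow> b i \<in> tors l" and ind: "independent 1 n b" by auto
  let ?f = "\<lambda>c. \<Sum>i<n. act (c i) (b i)" and ?X = "{..<n} \<rightarrow>\<^sub>E reduced 1"
  have "card (?f ` ?X) = CARD('f) ^ (n * degree l)"
    by (simp add: card_image[OF independent_inj[OF ind]] card_coeffs del: One_nat_def)
  also have "\<dots> < CARD('f) ^ (r * degree l)"
    using Suc.prems degree_l_pos q_gt_1 by (intro power_strict_increasing) auto
  also have "\<dots> = card (tors l)"
    using card_tors_l[of 1] by simp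
  finally have "card (?f ` ?X) < card (tors l)" .
  moreover have "finite (?f ` ?X)"
    by (intro finite_imageI finite_PiE finite_reduced) auto
  ultimately obtain z where z: "z \<in> tors l" "z \<notin> ?f ` ?X"
    by (meson card_mono linorder_not_le subsetI)
  define b' where "b' = b(n := z)"
  have "independent 1 (Suc n) b'"
    unfolding independent_def
  proof (intro allI impI)
    fix c i assume c: "(\<Sum>i<Suc n. act (c i) (b' i)) = 0" and i: "i < Suc n"
    have sum: "?f c + act (c n) z = 0"
      using c by (simp add: b'_def)
    \<comment> \<open>Otherwise c n is invertible modulo l, and solving the relation for z puts it
      into the span.\<close>
    have dvd: "l dvd c n"
    proof (rule ccontr)
      assume "\<not> l dvd c n"
      then obtain s where s: "l dvd s * c n - 1"
        using inverse_mod_irreducible[OF irreducible_l] by blast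
      have "act (s * c n - 1) z = 0" by (rule act_dvd_tors[OF s z(1)])
      hence "z = act s (act (c n) z)" by (simp add: act_diff_left act_mult)
      also have "act (c n) z = - ?f c" using sum by (simp add: eq_neg_iff_add_eq_0 add.commute)
      also have "act s (- ?f c) = (\<Sum>i<n. act (- (s * c i)) (b i))"
        using act_diff_right[of s 0 "?f c"] by (simp add: act_sum_right act_minus_left act_mult sum_negf)
      also have "\<dots> = (\<Sum>i<n. act (- (s * c i) mod l) (b i))"
        by (intro sum.cong refl act_mod_tors[symmetric] b) simp
      also have "\<dots> = ?f (\<lambda>i\<in>{..<n}. - (s * c i) mod l)"
        by (intro sum.cong) auto
      finally have "z = ?f (\<lambda>i\<in>{..<n}. - (s * c i) mod l)" .
      hence "z \<in> ?f ` ?X"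
        by (rule image_eqI[where x = "\<lambda>i\<in>{..<n}. - (s * c i) mod l"]) (auto simp: reduced_def)
      with z(2) show False by contradiction
    qed
    hence "act (c n) z = 0" by (rule act_dvd_tors[OF _ z(1)])
    with sum have "?f c = 0" by simp
    hence "\<forall>i<n. l dvd c i" using ind by (simp add: independent_def)
    with dvd i show "l ^ 1 dvd c i" by (auto simp: less_Suc_eq)
  qed
  moreover have "\<forall>i<Suc n. b' i \<in> tors l"
    using b z by (auto simp: b'_def less_Suc_eq)
  ultimately show ?case by blast
qed (simp add: independent_def)

section \<open>Compatible sequences of torsion points\<close>

definition tate :: "(nat \<Rightarrow> 'k) \<Rightarrow> bool" where
  "tate x \<longleftrightarrow> (\<forall>m. x m \<in> tors (l ^ m) \<and> act l (x (Suc m)) = x m)"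

lemma tate_act_power:
  assumes "\<And>m. act l (x (Suc m)) = x m"
  shows "act (l ^ j) (x (m + j)) = x m"
proof (induction j)
  case (Suc j)
  have "act (l ^ Suc j) (x (m + Suc j)) = act (l ^ j) (act l (x (Suc (m + j))))"
    by (simp add: act_mult act_commute[of l])
  thus ?case using Suc.IH assms by simp
qed simp

lemma tateI:
  assumes "x 0 = 0" "\<And>m. act l (x (Suc m)) = x m"
  shows "tate x"
  using tate_act_power[of x _ 0, OF assms(2)] assms by (simp add: tate_def tors_def)

text \<open>Below level m the entries are forced, by powers of l; above it, preimages under \<phi>_l
  exist over an algebraically closed field.\<close>

lemma tate_lift:
  assumes z: "z \<in> tors (l ^ m)"
  obtains x where "tate x" "x m = z"
proof -
  obtain g where g: "g 0 = z" "\<And>n. act l (g (Suc n)) = g n"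
  proof -
    have "\<exists>g. g 0 = z \<and> (\<forall>n. act l (g (Suc n)) = g n)"
      using dependent_nat_choice[of "\<lambda>n y. n = 0 \<longrightarrow> y = z" "\<lambda>n y y'. act l y' = y"]
        act_surj[OF l_nonzero] by (metis nat.distinct(1))
    thus ?thesis using that by blast
  qed
  define x where "x k = (if k \<le> m then act (l ^ (m - k)) z else g (k - m))" for k
  have "act l (x (Suc k)) = x k" for k
  proof (cases "k < m")
    case True
    hence "m - k = Suc (m - Suc k)" by simp
    thus ?thesis using True by (simp add: x_def act_mult)
  next
    case False
    hence "x (Suc k) = g (Suc (k - m))" "x k = g (k - m)"
      using g(1) by (auto simp: x_def Suc_diff_le)
    thus ?thesis by (simp add: g)
  qed
  moreover have "x 0 = 0" using z by (simp add: x_def tors_def)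
  ultimately have "tate x" by (intro tateI)
  moreover have "x m = z" by (simp add: x_def)
  ultimately show ?thesis by (rule that)
qed

definition adic :: "(nat \<Rightarrow> 'f poly) \<Rightarrow> bool" where
  "adic a \<longleftrightarrow> (\<forall>m. a m = a (Suc m) mod l ^ m)"

lemma adic_reduced: "adic a \<Longrightarrow> a m \<in> reduced m"
proof -
  assume "adic a"
  hence eq: "a m = a (Suc m) mod l ^ m" unfolding adic_def by (rule spec)
  hence "a m mod l ^ m = a (Suc m) mod l ^ m mod l ^ m" by (rule arg_cong)
  also have "\<dots> = a m" unfolding mod_mod_trivial by (rule eq[symmetric])
  finally show "a m \<in> reduced m" by (simp add: reduced_def)
qed

definition tate_basis :: "nat \<Rightarrow> (nat \<Rightarrow> nat \<Rightarrow> 'k) \<Rightarrow> bool" where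
  "tate_basis n b \<longleftrightarrow> (\<forall>i<n. tate (b i)) \<and>
     (\<forall>x. tate x \<longrightarrow> (\<exists>!c. c \<in> {..<n} \<rightarrow>\<^sub>E Collect adic \<and> (\<forall>m. x m = (\<Sum>i<n. act (c i m) (b i m)))))"

text \<open>A basis of the l-torsion is lifted to sequences. A relation at level m + 1, pushed down
  to level 1, has all coefficients divisible by l; after division it is a relation at level m, where
  induction applies. Counting then gives a basis at each level.\<close>

lemma tate_basis_exists: "\<exists>b. tate_basis r b"
proof -
  obtain b1 where b1: "\<And>i. i < r \<Longrightarrow> b1 i \<in> tors l" and ind1: "independent 1 r b1"
    using exists_independent[of r] by auto
  have "\<exists>x. tate x \<and> x 1 = b1 i" if "i < r" for i
    using tate_lift[of "b1 i" 1] b1[OF that] by auto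
  then obtain b where b: "\<And>i. i < r \<Longrightarrow> tate (b i)" "\<And>i. i < r \<Longrightarrow> b i 1 = b1 i"
    by metis
  have step: "act l (b i (Suc m)) = b i m" if "i < r" for i m
    using b(1)[OF that] by (simp add: tate_def)
  have ind: "independent m r (\<lambda>i. b i m)" for m
  proof (induction m)
    case 0
    thus ?case by (simp add: independent_def)
  next
    case (Suc m)
    show ?case unfolding independent_def
    proof (intro allI impI)
      fix c i assume c: "(\<Sum>i<r. act (c i) (b i (Suc m))) = 0" and i: "i < r"
      have "(\<Sum>i<r. act (c i) (b1 i)) = act (l ^ m) (\<Sum>i<r. act (c i) (b i (Suc m)))"
        unfolding act_sum_right
      proof (intro sum.cong refl)
        fix i assume "i \<in> {..<r}"
        thus "act (c i) (b1 i) = act (l ^ m) (act (c i) (b i (Suc m)))"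
          using tate_act_power[of "b i" m 1, OF step] b(2)[of i] act_commute[of "l ^ m"] by simp
      qed
      hence "\<forall>i<r. l dvd c i"
        using ind1 c by (simp add: independent_def)
      then obtain c' where c': "\<And>i. i < r \<Longrightarrow> c i = l * c' i"
        unfolding dvd_def by metis
      have "(\<Sum>i<r. act (c' i) (b i m)) = (\<Sum>i<r. act (c i) (b i (Suc m)))"
        by (intro sum.cong refl) (simp add: c' step act_mult act_commute[of l])
      hence "l ^ m dvd c' i" using Suc.IH c i by (simp add: independent_def)
      thus "l ^ Suc m dvd c i" using c'[OF i] by simp
    qed
  qed
  have tors: "b i m \<in> tors (l ^ m)" if "i < r" for i m
    using b(1)[OF that] by (simp add: tate_def)
  note bij = independent_bij[OF ind tors]
  have "\<exists>!c. c \<in> {..<r} \<rightarrow>\<^sub>E Collect adic \<and> (\<forall>m. x m = (\<Sum>i<r. act (c i m) (b i m)))"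
    if x: "tate x" for x
  proof -
    have "\<exists>c\<in>{..<r} \<rightarrow>\<^sub>E reduced m. x m = (\<Sum>i<r. act (c i) (b i m))" for m
      using x bij[of m] unfolding tate_def bij_betw_def by blast
    then obtain C where C: "\<And>m. C m \<in> {..<r} \<rightarrow>\<^sub>E reduced m"
      "\<And>m. x m = (\<Sum>i<r. act (C m i) (b i m))" by metis
    \<comment> \<open>Reducing the coefficients of level m + 1 and applying l to the points yields a
      second expansion of x m, so uniqueness at level m makes the coefficients compatible.\<close>
    have adic: "adic (\<lambda>m. C m i)" if i: "i < r" for i
      unfolding adic_def
    proof
      fix m
      define c where "c = (\<lambda>i\<in>{..<r}. C (Suc m) i mod l ^ m)"
      have "(\<Sum>i<r. act (c i) (b i m)) = (\<Sum>i<r. act (C (Suc m) i) (act l (b i (Suc m))))"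
        by (intro sum.cong refl) (simp add: c_def act_mod_tors tors step)
      also have "\<dots> = act l (x (Suc m))"
        by (simp add: C(2)[of "Suc m"] act_sum_right act_commute[of l])
      also have "\<dots> = x m" using x by (simp add: tate_def)
      also have "\<dots> = (\<Sum>i<r. act (C m i) (b i m))" by (rule C(2))
      finally have "c = C m"
        by (rule inj_onD[OF independent_inj[OF ind] _ _ C(1)])
          (auto simp: c_def reduced_def split: if_splits)
      thus "C m i = C (Suc m) i mod l ^ m" using i by (metis c_def lessThan_iff restrict_apply')
    qed
    show ?thesis
    proof (rule ex1I[of _ "\<lambda>i\<in>{..<r}. \<lambda>m. C m i"], goal_cases)
      case 1
      thus ?case using adic C(2) by auto
    next
      case (2 c)
      have red: "(\<lambda>i\<in>{..<r}. c i m) \<in> {..<r} \<rightarrow>\<^sub>E reduced m" for m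
        using 2 adic_reduced by auto
      have "(\<lambda>i\<in>{..<r}. c i m) = C m" for m
      proof (rule inj_onD[OF independent_inj[OF ind[of m]] _ red C(1)])
        show "(\<Sum>i<r. act ((\<lambda>i\<in>{..<r}. c i m) i) (b i m)) = (\<Sum>i<r. act (C m i) (b i m))"
          using 2 C(2)[of m] by (auto simp flip: C(2) intro!: sum.cong)
      qed
      hence "c i m = C m i" if "i < r" for i m
        using that by (metis lessThan_iff restrict_apply')
      thus ?case
        using 2 by (intro PiE_ext[of c "{..<r}" "\<lambda>_. Collect adic"]) (use adic in auto)
    qed
  qed
  thus ?thesis using b(1) by (auto simp: tate_basis_def)
qed

lemma adic_mod: "adic (\<lambda>m. c mod l ^ m)"
  by (simp add: adic_def mod_mod_cancel le_imp_power_dvd)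

lemma adic_mult_l: "adic d \<Longrightarrow> adic (\<lambda>m. (l * d m) mod l ^ m)"
  unfolding adic_def by (metis (no_types, lifting) mod_mod_cancel le_imp_power_dvd le_add2 mod_mult_right_eq plus_1_eq_Suc)

lemma tate_basis_generates:
  assumes "tate_basis n b" "z \<in> tors (l ^ m)"
  shows "\<exists>c\<in>{..<n} \<rightarrow>\<^sub>E reduced m. z = (\<Sum>i<n. act (c i) (b i m))"
proof -
  obtain x where x: "tate x" "x m = z" using tate_lift[OF assms(2)] by blast
  then obtain c where c: "c \<in> {..<n} \<rightarrow>\<^sub>E Collect adic" "\<And>m. x m = (\<Sum>i<n. act (c i m) (b i m))"
    using assms(1) unfolding tate_basis_def by meson
  show ?thesis
  proof (rule bexI[of _ "\<lambda>i\<in>{..<n}. c i m"])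
    show "z = (\<Sum>i<n. act ((\<lambda>i\<in>{..<n}. c i m) i) (b i m))" using c(2) x(2) by auto
    show "(\<lambda>i\<in>{..<n}. c i m) \<in> {..<n} \<rightarrow>\<^sub>E reduced m" using c(1) adic_reduced by auto
  qed
qed

text \<open>A relation at level 1 says that the sequence x with coefficients c has x 1 = 0. Its
  shift is therefore again compatible, and x is l times the shift. If d are the coordinates of the
  shift, uniqueness for x identifies c with l d, and level 1 gives the divisibility.\<close>

lemma tate_basis_independent:
  assumes "tate_basis n b"
  shows "independent 1 n (\<lambda>i. b i 1)"
  unfolding independent_def
proof (intro allI impI)
  fix c i assume c: "(\<Sum>i<n. act (c i) (b i 1)) = 0" and i: "i < n"
  have b: "b i m \<in> tors (l ^ m)" "act l (b i (Suc m)) = b i m" if "i < n" for i m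
    using assms that by (auto simp: tate_basis_def tate_def)
  define x where "x m = (\<Sum>i<n. act (c i) (b i m))" for m
  have step: "act l (x (Suc m)) = x m" for m
    unfolding x_def act_sum_right by (intro sum.cong refl) (simp add: act_commute[of l] b)
  have x1: "x (Suc 0) = 0" using c by (simp add: x_def)
  have "tate (\<lambda>m. x (Suc m))" by (rule tateI) (use x1 step in auto)
  then obtain d where d: "d \<in> {..<n} \<rightarrow>\<^sub>E Collect adic" "\<And>m. x (Suc m) = (\<Sum>i<n. act (d i m) (b i m))"
    using assms unfolding tate_basis_def by meson
  have "tate x" using step[of 0] x1 by (intro tateI step) simp
  hence "\<exists>!c. c \<in> {..<n} \<rightarrow>\<^sub>E Collect adic \<and> (\<forall>m. x m = (\<Sum>i<n. act (c i m) (b i m)))"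
    using assms unfolding tate_basis_def by blast
  moreover have "(\<lambda>i\<in>{..<n}. \<lambda>m. c i mod l ^ m) \<in> {..<n} \<rightarrow>\<^sub>E Collect adic"
    using adic_mod by auto
  moreover have "x m = (\<Sum>j<n. act ((\<lambda>i\<in>{..<n}. \<lambda>m. c i mod l ^ m) j m) (b j m))" for m
    unfolding x_def by (intro sum.cong refl) (simp add: act_mod_tors b)
  moreover have "(\<lambda>i\<in>{..<n}. \<lambda>m. (l * d i m) mod l ^ m) \<in> {..<n} \<rightarrow>\<^sub>E Collect adic"
    using d(1) adic_mult_l by auto
  moreover have "x m = (\<Sum>j<n. act ((\<lambda>i\<in>{..<n}. \<lambda>m. (l * d i m) mod l ^ m) j m) (b j m))" for m
  proof -
    have "x m = act l (x (Suc m))" by (simp add: step)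
    also have "\<dots> = (\<Sum>j<n. act ((\<lambda>i\<in>{..<n}. \<lambda>m. (l * d i m) mod l ^ m) j m) (b j m))"
      unfolding d(2) act_sum_right by (intro sum.cong refl) (simp add: act_mod_tors b act_mult)
    finally show ?thesis .
  qed
  ultimately have "(\<lambda>i\<in>{..<n}. \<lambda>m. c i mod l ^ m) = (\<lambda>i\<in>{..<n}. \<lambda>m. (l * d i m) mod l ^ m)"
    by blast
  from fun_cong[OF fun_cong[OF this, of i], of 1] have "c i mod l ^ 1 = (l * d i 1) mod l ^ 1"
    using i by simp
  thus "l ^ 1 dvd c i" by (simp add: dvd_eq_mod_eq_0)
qed

text \<open>\<open>module_det\<close> lets the size of the basis vary; counting the l-torsion
  through a basis of size n gives q^(n deg l) against q^(r deg l).\<close>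

lemma tate_basis_rank:
  assumes "tate_basis n b"
  shows "n = r"
proof -
  let ?f = "\<lambda>c. \<Sum>i<n. act (c i) (b i 1)" and ?X = "{..<n} \<rightarrow>\<^sub>E reduced 1"
  have "?f ` ?X = tors (l ^ 1)"
  proof (intro equalityI subsetI)
    fix z assume "z \<in> tors (l ^ 1)"
    thus "z \<in> ?f ` ?X" using tate_basis_generates[OF assms, of z 1] by blast
  next
    fix z assume "z \<in> ?f ` ?X"
    then obtain c where "z = (\<Sum>i<n. act (c i) (b i 1))" by blast
    moreover have bm: "b i m \<in> tors (l ^ m)" if "i < n" for i m
      using assms that by (simp add: tate_basis_def tate_def)
    have "b i (Suc 0) \<in> tors l" if "i < n" for i
      using bm[OF that, of 1] by simp
    ultimately show "z \<in> tors (l ^ 1)" by (auto intro!: sum_tors act_tors)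
  qed
  hence "card ?X = card (tors (l ^ 1))"
    using card_image[OF independent_inj[OF tate_basis_independent[OF assms]]] by simp
  hence "n * (1 * degree l) = r * (1 * degree l)"
    unfolding card_coeffs card_tors_l using q_gt_1 by (simp only: power_inject_exp)
  thus ?thesis using degree_l_pos by simp
qed

text \<open>At level m the entries are plain polynomials that describe u on the l^m-torsion, so
  \<open>det_torsion\<close> applies with a = l^m.\<close>

lemma tate_det:
  assumes b: "tate_basis r b"
    and u: "\<And>a. skew_mult CARD('f) u (F a) = skew_mult CARD('f) (F a) u"
    and A: "\<And>j m. j < r \<Longrightarrow> ev u (b j m) = (\<Sum>i<r. act (A i j m) (b i m))"
    and d: "map_poly e d = mdet u"
  shows "(\<Sum>p | p permutes {..<r}. of_int (sign p) * (\<Prod>i<r. A i (p i) m)) mod l ^ m = d mod l ^ m"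
proof -
  let ?U = "mat r r (\<lambda>(i, j). A i j m)"
  have "[det ?U = d] (mod l ^ m)"
  proof (rule det_torsion[OF power_l_not_char _ _ u _ _ d])
    show "b s m \<in> tors (l ^ m)" if "s < r" for s
      using b that by (simp add: tate_basis_def tate_def)
    show "\<exists>c. z = (\<Sum>s<r. act (c s) (b s m))" if "z \<in> tors (l ^ m)" for z
      using tate_basis_generates[OF b that] by blast
    show "ev u (b s m) = (\<Sum>t<r. act (?U $$ (t, s)) (b t m))" if "s < r" for s
      using A that by simp
  qed simp
  moreover have "det ?U = (\<Sum>p | p permutes {..<r}. of_int (sign p) * (\<Prod>i<r. A i (p i) m))"
    by (subst det_def'[of _ r]) (auto simp: atLeast0LessThan permutes_in_image intro!: sum.cong prod.cong)
  ultimately show ?thesis by (simp add: cong_def)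
qed

end

section \<open>Comparison with the Tate module\<close>

lemma (in drinfeld_closed) commute_FT:
  assumes "skew_mult CARD('f) u FT = skew_mult CARD('f) FT u"
  shows "skew_mult CARD('f) u (F a) = skew_mult CARD('f) (F a) u"
proof (induction a)
  case (pCons c a)
  have const: "skew_mult CARD('f) u [:e c:] = skew_mult CARD('f) [:e c:] u"
    by (rule ev_inject) (simp add: ev_mult ev_e_scale)
  have "skew_mult CARD('f) u (skew_mult CARD('f) (F a) FT) = skew_mult CARD('f) (skew_mult CARD('f) (F a) FT) u"
    using assms pCons.IH by (metis smul_assoc)
  thus ?case by (simp add: F_pCons smul_add_left smul_add_right const)
qed simp

lemma (in drinfeld_closed) mdet_0: "mdet 0 = 0"
proof -
  have "coords 0 j = 0" if "j < r" for j
    by (rule lincomb_inject[OF _ that]) (simp add: lincomb_coords, simp add: lincomb_def)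
  hence "motive_mat 0 = 0\<^sub>m r r"
    by (intro eq_matI) (auto simp: motive_mat_def)
  thus ?thesis using r_pos by (simp add: mdet_def)
qed

section \<open>The completion of F_q[T] at l\<close>

lemma carrier_adic_ring: "a \<in> carrier (adic_ring l) \<longleftrightarrow> (\<forall>m. a m = a (Suc m) mod l ^ m)"
  by (simp add: adic_ring_def)

lemma adic_ring_mod: "a \<in> carrier (adic_ring l) \<Longrightarrow> a m mod l ^ m = a m"
  unfolding carrier_adic_ring by (metis mod_mod_trivial)

lemma adic_ring_Suc: "a \<in> carrier (adic_ring l) \<Longrightarrow> a (Suc m) mod l ^ m = a m"
  unfolding carrier_adic_ring by metis

lemma mod_power_Suc_mod: "(x mod l ^ Suc m) mod l ^ m = (x :: 'f::field poly) mod l ^ m"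
  by (rule mod_mod_cancel) (simp add: le_imp_power_dvd)

lemma cring_adic_ring: "cring (adic_ring l)"
proof -
  let ?R = "adic_ring l"
  have carr: "x \<in> carrier ?R" if "\<And>m. x m = x (Suc m) mod l ^ m" for x
    unfolding carrier_adic_ring using that by blast
  have ops: "x \<oplus>\<^bsub>?R\<^esub> y = (\<lambda>m. (x m + y m) mod l ^ m)" "x \<otimes>\<^bsub>?R\<^esub> y = (\<lambda>m. (x m * y m) mod l ^ m)"
    "\<zero>\<^bsub>?R\<^esub> = (\<lambda>m. 0)" "\<one>\<^bsub>?R\<^esub> = (\<lambda>m. 1 mod l ^ m)" for x y
    by (simp_all add: adic_ring_def)
  have add: "x \<oplus>\<^bsub>?R\<^esub> y \<in> carrier ?R" if "x \<in> carrier ?R" "y \<in> carrier ?R" for x y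
  proof (rule carr)
    fix m show "(x \<oplus>\<^bsub>?R\<^esub> y) m = (x \<oplus>\<^bsub>?R\<^esub> y) (Suc m) mod l ^ m"
      unfolding ops mod_power_Suc_mod
      by (subst mod_add_eq[symmetric, of "x (Suc m)"]) (simp only: adic_ring_Suc that)
  qed
  have mult: "x \<otimes>\<^bsub>?R\<^esub> y \<in> carrier ?R" if "x \<in> carrier ?R" "y \<in> carrier ?R" for x y
  proof (rule carr)
    fix m show "(x \<otimes>\<^bsub>?R\<^esub> y) m = (x \<otimes>\<^bsub>?R\<^esub> y) (Suc m) mod l ^ m"
      unfolding ops mod_power_Suc_mod
      by (subst mod_mult_eq[symmetric, of "x (Suc m)"]) (simp only: adic_ring_Suc that)
  qed
  have zero: "\<zero>\<^bsub>?R\<^esub> \<in> carrier ?R" by (rule carr) (simp add: ops)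
  have one: "\<one>\<^bsub>?R\<^esub> \<in> carrier ?R"
    by (rule carr) (simp only: ops mod_power_Suc_mod)
  have neg: "(\<lambda>m. (- x m) mod l ^ m) \<in> carrier ?R" if "x \<in> carrier ?R" for x
  proof (rule carr)
    fix m show "(- x m) mod l ^ m = (- x (Suc m)) mod l ^ Suc m mod l ^ m"
      unfolding mod_power_Suc_mod
      by (subst mod_minus_eq[symmetric, of "x (Suc m)"]) (simp only: adic_ring_Suc that)
  qed
  show ?thesis
  proof (rule cringI)
    show "abelian_group ?R"
    proof (rule abelian_groupI)
      fix x assume x: "x \<in> carrier ?R"
      show "\<exists>y\<in>carrier ?R. y \<oplus>\<^bsub>?R\<^esub> x = \<zero>\<^bsub>?R\<^esub>"
        by (rule bexI[OF _ neg[OF x]]) (simp add: ops mod_add_left_eq)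
    qed (use add zero in \<open>auto simp: ops fun_eq_iff mod_simps add_ac adic_ring_mod\<close>)
    show "Group.comm_monoid ?R"
      by (rule comm_monoidI)
        (use mult one in \<open>auto simp: ops fun_eq_iff mod_simps mult_ac adic_ring_mod\<close>)
  qed (auto simp: ops fun_eq_iff mod_simps ring_distribs)
qed

text \<open>The ring sum reduces after every addition, whereas the plain sum does not; a congruence
  is what connects them at level m.\<close>

lemma adic_finsum_cong:
  assumes "finite S" "\<And>x. x \<in> S \<Longrightarrow> f x \<in> carrier (adic_ring l)"
  shows "[(\<Oplus>\<^bsub>adic_ring l\<^esub>x\<in>S. f x) m = (\<Sum>x\<in>S. f x m)] (mod l ^ m)"
proof -
  interpret cring "adic_ring l" by (rule cring_adic_ring)
  show ?thesis using assms
  proof (induction S rule: finite_induct)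
    case (insert x S)
    have "(\<Oplus>\<^bsub>adic_ring l\<^esub>x\<in>insert x S. f x) = f x \<oplus>\<^bsub>adic_ring l\<^esub> (\<Oplus>\<^bsub>adic_ring l\<^esub>x\<in>S. f x)"
      using insert by (intro finsum_insert) auto
    hence "[(\<Oplus>\<^bsub>adic_ring l\<^esub>x\<in>insert x S. f x) m = f x m + (\<Oplus>\<^bsub>adic_ring l\<^esub>x\<in>S. f x) m] (mod l ^ m)"
      by (simp add: adic_ring_def cong_def)
    also have "[f x m + (\<Oplus>\<^bsub>adic_ring l\<^esub>x\<in>S. f x) m = f x m + (\<Sum>x\<in>S. f x m)] (mod l ^ m)"
      using insert by (intro cong_add cong_refl) auto
    finally show ?case using insert.hyps by simp
  next
    case empty
    have "\<zero>\<^bsub>adic_ring l\<^esub> m = 0" by (simp add: adic_ring_def)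
    thus ?case by simp
  qed
qed

lemma adic_finprod_cong:
  assumes "finite S" "\<And>x. x \<in> S \<Longrightarrow> f x \<in> carrier (adic_ring l)"
  shows "[(\<Otimes>\<^bsub>adic_ring l\<^esub>x\<in>S. f x) m = (\<Prod>x\<in>S. f x m)] (mod l ^ m)"
proof -
  interpret cring "adic_ring l" by (rule cring_adic_ring)
  show ?thesis using assms
  proof (induction S rule: finite_induct)
    case (insert x S)
    have "(\<Otimes>\<^bsub>adic_ring l\<^esub>x\<in>insert x S. f x) = f x \<otimes>\<^bsub>adic_ring l\<^esub> (\<Otimes>\<^bsub>adic_ring l\<^esub>x\<in>S. f x)"
      using insert by (intro finprod_insert) auto
    hence "[(\<Otimes>\<^bsub>adic_ring l\<^esub>x\<in>insert x S. f x) m = f x m * (\<Otimes>\<^bsub>adic_ring l\<^esub>x\<in>S. f x) m] (mod l ^ m)"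
      by (simp add: adic_ring_def cong_def)
    also have "[f x m * (\<Otimes>\<^bsub>adic_ring l\<^esub>x\<in>S. f x) m = f x m * (\<Prod>x\<in>S. f x m)] (mod l ^ m)"
      using insert by (intro cong_mult cong_refl) auto
    finally show ?case using insert.hyps by simp
  next
    case empty
    have "[\<one>\<^bsub>adic_ring l\<^esub> m = 1] (mod l ^ m)" by (simp add: adic_ring_def cong_def)
    thus ?case by simp
  qed
qed

lemma ring_det_adic_ring:
  assumes A: "\<And>i j. i < n \<Longrightarrow> j < n \<Longrightarrow> A i j \<in> carrier (adic_ring l)"
  shows "ring_det (adic_ring l) n A m =
    (\<Sum>p | p permutes {..<n}. of_int (sign p) * (\<Prod>i<n. A i (p i) m)) mod l ^ m"
proof -
  let ?R = "adic_ring l"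
  interpret cring ?R by (rule cring_adic_ring)
  let ?t = "\<lambda>p. (if evenperm p then \<one>\<^bsub>?R\<^esub> else \<ominus>\<^bsub>?R\<^esub> \<one>\<^bsub>?R\<^esub>) \<otimes>\<^bsub>?R\<^esub> (\<Otimes>\<^bsub>?R\<^esub>i\<in>{..<n}. A i (p i))"
  have p_lt: "p i < n" if "p permutes {..<n}" "i < n" for p i
    using permutes_in_image[OF that(1), of i] that(2) by simp
  have prod: "(\<Otimes>\<^bsub>?R\<^esub>i\<in>{..<n}. A i (p i)) \<in> carrier ?R" if "p permutes {..<n}" for p
    by (rule finprod_closed) (use A p_lt[OF that] in auto)
  have t: "?t p \<in> carrier ?R" if "p permutes {..<n}" for p
    using prod[OF that] by (intro m_closed) auto
  \<comment> \<open>The additive inverse in the ring is abstract; its coordinate is recognised from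
    -1 + 1 = 0 at level m.\<close>
  have sgn: "[(if evenperm p then \<one>\<^bsub>?R\<^esub> else \<ominus>\<^bsub>?R\<^esub> \<one>\<^bsub>?R\<^esub>) m = of_int (sign p)] (mod l ^ m)" for p :: "nat \<Rightarrow> nat"
  proof -
    have "(\<ominus>\<^bsub>?R\<^esub> \<one>\<^bsub>?R\<^esub> \<oplus>\<^bsub>?R\<^esub> \<one>\<^bsub>?R\<^esub>) m = 0"
      by (simp add: l_neg) (simp add: adic_ring_def)
    hence "[(\<ominus>\<^bsub>?R\<^esub> \<one>\<^bsub>?R\<^esub>) m + 1 = 0] (mod l ^ m)"
      by (simp add: adic_ring_def cong_def mod_simps)
    hence "[(\<ominus>\<^bsub>?R\<^esub> \<one>\<^bsub>?R\<^esub>) m = - 1] (mod l ^ m)"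
      by (simp add: cong_iff_dvd_diff)
    moreover have "[\<one>\<^bsub>?R\<^esub> m = 1] (mod l ^ m)"
      by (simp add: adic_ring_def cong_def)
    ultimately show ?thesis by (simp add: sign_def)
  qed
  have "[ring_det ?R n A m = (\<Sum>p | p permutes {..<n}. ?t p m)] (mod l ^ m)"
    unfolding ring_det_def by (rule adic_finsum_cong) (use t in \<open>auto simp: finite_permutations\<close>)
  also have "[(\<Sum>p | p permutes {..<n}. ?t p m) =
      (\<Sum>p | p permutes {..<n}. of_int (sign p) * (\<Prod>i<n. A i (p i) m))] (mod l ^ m)"
  proof (rule cong_sum)
    fix p assume "p \<in> {p. p permutes {..<n}}"
    hence p: "p permutes {..<n}" by simp
    have "[?t p m = (if evenperm p then \<one>\<^bsub>?R\<^esub> else \<ominus>\<^bsub>?R\<^esub> \<one>\<^bsub>?R\<^esub>) m * (\<Otimes>\<^bsub>?R\<^esub>i\<in>{..<n}. A i (p i)) m] (mod l ^ m)"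
      by (simp add: adic_ring_def cong_def)
    also have "[(if evenperm p then \<one>\<^bsub>?R\<^esub> else \<ominus>\<^bsub>?R\<^esub> \<one>\<^bsub>?R\<^esub>) m * (\<Otimes>\<^bsub>?R\<^esub>i\<in>{..<n}. A i (p i)) m =
        of_int (sign p) * (\<Prod>i<n. A i (p i) m)] (mod l ^ m)"
      by (intro cong_mult sgn adic_finprod_cong) (use A p_lt[OF p] in auto)
    finally show "[?t p m = of_int (sign p) * (\<Prod>i<n. A i (p i) m)] (mod l ^ m)" .
  qed
  finally have "[ring_det ?R n A m =
      (\<Sum>p | p permutes {..<n}. of_int (sign p) * (\<Prod>i<n. A i (p i) m))] (mod l ^ m)" .
  moreover have "ring_det ?R n A \<in> carrier ?R"
    unfolding ring_det_def by (rule finsum_closed) (use t in auto)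
  ultimately show ?thesis by (simp add: cong_def adic_ring_mod)
qed

section \<open>Passage from k to its algebraic closure\<close>

lemma field_hom_to_ac: "field_hom (to_ac :: 'k::field \<Rightarrow> 'k alg_closure)"
  by unfold_locales simp_all

lemma skew_eval_eq: "skew_eval q f z = skew_ev q (map_poly to_ac f) z"
  by (simp add: skew_eval_def skew_ev_def degree_map_poly coeff_map_poly)

lemma map_poly_to_ac_skew_mult:
  fixes f g :: "'k::field poly"
  shows "map_poly to_ac (skew_mult q f g) = skew_mult q (map_poly to_ac f) (map_poly to_ac g)"
proof -
  interpret to_ac: field_hom "to_ac :: 'k \<Rightarrow> 'k alg_closure" by (rule field_hom_to_ac)
  interpret p: map_poly_inj_idom_hom "to_ac :: 'k \<Rightarrow> 'k alg_closure" ..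
  show ?thesis
    by (simp add: skew_mult_def p.hom_sum degree_map_poly coeff_map_poly map_poly_monom)
qed

lemma map_poly_to_ac_inj [simp]: "map_poly to_ac f = map_poly to_ac g \<longleftrightarrow> f = g"
  by (simp add: poly_eq_iff coeff_map_poly)

text \<open>A polynomial of least degree vanishing at g_0 divides l, so irreducibility forces equal
  degrees; two monic candidates differ by a polynomial of smaller degree with the same root. Used in
  contrapositive form, to show that other primes do not vanish at g_0.\<close>

lemma irreducible_eq_drinfeld_char:
  assumes emb: "is_field_embedding \<iota>" and l: "Factorial_Ring.irreducible l" "lead_coeff l = 1"
    and root: "poly (map_poly \<iota> l) (coeff (\<phi> [:0, 1:]) 0) = 0"
  shows "drinfeld_char \<iota> \<phi> = l"
proof -
  define g where "g = coeff (\<phi> [:0, 1:]) 0"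
  interpret field_hom \<iota> by (rule is_field_embedding_hom[OF emb])
  interpret p: map_poly_inj_idom_hom \<iota> ..
  let ?root = "\<lambda>p. poly (map_poly \<iota> p) g = 0"
  have degl: "degree l > 0"
  proof (rule ccontr)
    assume "\<not> degree l > 0"
    moreover have "l \<noteq> 0" using l(1) by auto
    ultimately have "is_unit l" using is_unit_iff_degree by blast
    thus False using Factorial_Ring.irreducible_not_unit[OF l(1)] by blast
  qed
  have min: "degree l \<le> degree p'" if "p' \<noteq> 0" "?root p'" for p'
  proof -
    have "p' \<noteq> 0 \<and> ?root p'" using that by blast
    from ex_has_least_nat[of "\<lambda>p. p \<noteq> 0 \<and> ?root p", OF this, of degree]
    obtain p where p: "p \<noteq> 0" "?root p" and p_min: "\<And>y. y \<noteq> 0 \<Longrightarrow> ?root y \<Longrightarrow> degree p \<le> degree y"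
      by blast
    have "l mod p = 0"
    proof (rule ccontr)
      assume nz: "l mod p \<noteq> 0"
      have "l mod p = l - p * (l div p)" by (simp add: minus_mult_div_eq_mod)
      hence "?root (l mod p)"
        using root p(2) by (simp add: p.hom_minus p.hom_mult g_def)
      with p_min nz have "degree p \<le> degree (l mod p)" by blast
      thus False using degree_mod_less[OF p(1), of l] nz by simp
    qed
    hence "p dvd l" by (simp add: mod_eq_0_iff_dvd)
    then obtain c where c: "l = p * c" unfolding dvd_def by blast
    have "\<not> is_unit p"
    proof
      assume "is_unit p"
      hence "degree p = 0" using is_unit_iff_degree[OF p(1)] by simp
      then obtain a where "p = [:a:]" by (rule degree_eq_zeroE)
      thus False using p by simp
    qed
    with c l(1) have "is_unit c" using Factorial_Ring.irreducibleD by blast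
    moreover have "c \<noteq> 0" using c l(1) by auto
    ultimately have "degree l = degree p"
      using p(1) unfolding c by (simp add: degree_mult_eq is_unit_iff_degree)
    thus ?thesis using p_min that by simp
  qed
  show ?thesis
    unfolding drinfeld_char_def Let_def g_def[symmetric]
  proof (rule the_equality)
    show "lead_coeff l = 1 \<and> ?root l \<and> (\<forall>p'. p' \<noteq> 0 \<longrightarrow> ?root p' \<longrightarrow> degree l \<le> degree p')"
      using l(2) root min by (simp add: g_def)
  next
    fix p assume p: "lead_coeff p = 1 \<and> ?root p \<and> (\<forall>p'. p' \<noteq> 0 \<longrightarrow> ?root p' \<longrightarrow> degree p \<le> degree p')"
    show "p = l"
    proof (rule ccontr)
      assume ne: "p \<noteq> l"
      have "l \<noteq> 0" "p \<noteq> 0" using l p by auto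
      hence deg: "degree p = degree l" using p min root by (simp add: antisym g_def)
      have "?root (p - l)" using p root by (simp add: p.hom_minus g_def)
      hence "degree l \<le> degree (p - l)" using min ne by simp
      moreover have "degree (p - l) < degree l"
      proof (rule degree_lessI)
        show "\<forall>k\<ge>degree l. coeff (p - l) k = 0"
        proof (intro allI impI)
          fix k assume "k \<ge> degree l"
          thus "coeff (p - l) k = 0"
            using p l(2) deg by (cases "k = degree l") (auto simp: coeff_eq_0)
        qed
      qed (use ne in simp)
      ultimately show False by simp
    qed
  qed
qed

locale drinfeld =
  fixes \<iota> :: "'f::finite_field \<Rightarrow> 'k::field" and r :: nat and \<phi> :: "'f poly \<Rightarrow> 'k poly"
  assumes drinfeld_module: "drinfeld_module \<iota> r \<phi>"
begin

abbreviation e :: "'f \<Rightarrow> 'k alg_closure" where "e \<equiv> \<lambda>c. to_ac (\<iota> c)"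
abbreviation F :: "'f poly \<Rightarrow> 'k alg_closure poly" where "F \<equiv> \<lambda>a. map_poly to_ac (\<phi> a)"

lemma embedding: "is_field_embedding \<iota>"
  using drinfeld_module by (simp add: drinfeld_module_def)

lemma drinfeld_module_closure: "drinfeld_module e r F"
proof -
  interpret to_ac: field_hom "to_ac :: 'k \<Rightarrow> 'k alg_closure" by (rule field_hom_to_ac)
  interpret p: map_poly_inj_idom_hom "to_ac :: 'k \<Rightarrow> 'k alg_closure" ..
  show ?thesis
    using drinfeld_module unfolding drinfeld_module_def is_field_embedding_def
    by (auto simp: map_poly_to_ac_skew_mult p.hom_add degree_map_poly inj_def to_ac.map_poly_pCons_hom)
qed

sublocale closed: drinfeld_closed e r F
  by unfold_locales (rule drinfeld_module_closure)

lemma prime_locale: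
  assumes l: "Factorial_Ring.irreducible l" "lead_coeff l = 1" "l \<noteq> drinfeld_char \<iota> \<phi>"
  shows "drinfeld_prime e r F l"
proof
  interpret \<iota>: field_hom \<iota> by (rule is_field_embedding_hom[OF embedding])
  show "Factorial_Ring.irreducible l" by fact
  have "poly (map_poly \<iota> l) (coeff (\<phi> [:0, 1:]) 0) \<noteq> 0"
    using irreducible_eq_drinfeld_char[OF embedding l(1,2), of \<phi>] l(3) by auto
  moreover have "poly (map_poly e l) (to_ac x) = to_ac (poly (map_poly \<iota> l) x)" for x
    by (induction l) (simp_all add: \<iota>.map_poly_pCons_hom closed.e.map_poly_pCons_hom)
  ultimately show "poly (map_poly e l) (coeff closed.FT 0) \<noteq> 0"
    by (simp add: closed.FT_def coeff_map_poly)
qed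

end

section \<open>The Tate module over the completion\<close>

locale drinfeld_tate = drinfeld \<iota> r \<phi>
  for \<iota> :: "'f::finite_field \<Rightarrow> 'k::field" and r \<phi> +
  fixes l :: "'f poly"
  assumes prime_l: "drinfeld_prime e r F l"
begin

sublocale prime: drinfeld_prime e r F l by (rule prime_l)

abbreviation M where "M \<equiv> tate_module \<phi> l"
abbreviation R where "R \<equiv> adic_ring l"

lemma carrier_M: "carrier M = Collect prime.tate"
  by (auto simp: tate_module_def prime.tate_def drinfeld_torsion_def closed.tors_def closed.act_def
    skew_eval_eq)

lemma carrier_R: "carrier R = Collect prime.adic"
  by (rule Set.set_eqI) (simp only: carrier_adic_ring mem_Collect_eq prime.adic_def)

lemma smult_M: "a \<odot>\<^bsub>M\<^esub> x = (\<lambda>m. closed.act (a m) (x m))"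
  by (simp add: tate_module_def closed.act_def skew_eval_eq)

lemma add_M: "x \<oplus>\<^bsub>M\<^esub> y = (\<lambda>m. x m + y m)" and zero_M: "\<zero>\<^bsub>M\<^esub> = (\<lambda>m. 0)"
  by (simp_all add: tate_module_def)

lemma abelian_monoid_M: "abelian_monoid M"
proof (rule abelian_monoidI)
  fix x y assume "x \<in> carrier M" "y \<in> carrier M"
  thus "x \<oplus>\<^bsub>M\<^esub> y \<in> carrier M"
    by (simp add: carrier_M add_M prime.tate_def closed.act_add_right closed.tors_def)
next
  show "\<zero>\<^bsub>M\<^esub> \<in> carrier M"
    by (simp add: carrier_M zero_M prime.tate_def closed.tors_def)
qed (simp_all add: add_M zero_M add_ac)

lemma smult_M_closed:
  assumes "a \<in> carrier R" "x \<in> carrier M"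
  shows "a \<odot>\<^bsub>M\<^esub> x \<in> carrier M"
proof -
  have x: "x m \<in> closed.tors (l ^ m)" "closed.act l (x (Suc m)) = x m" for m
    using assms(2) by (simp_all add: carrier_M prime.tate_def)
  have "closed.act l (closed.act (a (Suc m)) (x (Suc m))) = closed.act (a m) (x m)" for m
  proof -
    have "closed.act l (closed.act (a (Suc m)) (x (Suc m))) = closed.act (a (Suc m)) (x m)"
      by (simp add: closed.act_commute[of l] x)
    also have "\<dots> = closed.act (a (Suc m) mod l ^ m) (x m)"
      by (rule prime.act_mod_tors[OF x(1), symmetric])
    finally show ?thesis by (simp only: adic_ring_Suc[OF assms(1)])
  qed
  thus ?thesis
    using x prime.act_tors by (simp add: carrier_M smult_M prime.tate_def)
qed

lemma finsum_M:
  assumes "finite S" "\<And>i. i \<in> S \<Longrightarrow> f i \<in> carrier M"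
  shows "(\<Oplus>\<^bsub>M\<^esub>i\<in>S. f i) = (\<lambda>m. \<Sum>i\<in>S. f i m)"
proof -
  interpret abelian_monoid M by (rule abelian_monoid_M)
  show ?thesis using assms
  proof (induction S rule: finite_induct)
    case (insert x S)
    have "(\<Oplus>\<^bsub>M\<^esub>i\<in>insert x S. f i) = f x \<oplus>\<^bsub>M\<^esub> (\<Oplus>\<^bsub>M\<^esub>i\<in>S. f i)"
      using insert by (intro finsum_insert) auto
    thus ?case using insert by (simp add: add_M)
  qed (simp add: zero_M)
qed

lemma lincomb_M:
  fixes n :: nat
  assumes "\<And>i. i < n \<Longrightarrow> c i \<in> carrier R" "\<And>i. i < n \<Longrightarrow> b i \<in> carrier M"
  shows "(\<Oplus>\<^bsub>M\<^esub>i\<in>{..<n}. c i \<odot>\<^bsub>M\<^esub> b i) = (\<lambda>m. \<Sum>i<n. closed.act (c i m) (b i m))"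
  by (subst finsum_M) (use assms smult_M_closed in \<open>auto simp: smult_M\<close>)

lemma is_module_basis_iff: "is_module_basis R M n b \<longleftrightarrow> prime.tate_basis n b"
proof (cases "\<forall>i<n. b i \<in> carrier M")
  case True
  have "x = (\<Oplus>\<^bsub>M\<^esub>i\<in>{..<n}. c i \<odot>\<^bsub>M\<^esub> b i) \<longleftrightarrow> (\<forall>m. x m = (\<Sum>i<n. closed.act (c i m) (b i m)))"
    if "c \<in> {..<n} \<rightarrow>\<^sub>E carrier R" for c x
    by (subst lincomb_M) (use that True in \<open>auto simp: fun_eq_iff\<close>)
  hence "(c \<in> {..<n} \<rightarrow>\<^sub>E carrier R \<and> x = (\<Oplus>\<^bsub>M\<^esub>i\<in>{..<n}. c i \<odot>\<^bsub>M\<^esub> b i)) \<longleftrightarrow>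
      (c \<in> {..<n} \<rightarrow>\<^sub>E Collect prime.adic \<and> (\<forall>m. x m = (\<Sum>i<n. closed.act (c i m) (b i m))))" for c x
    unfolding carrier_R[symmetric] by blast
  thus ?thesis
    unfolding is_module_basis_def prime.tate_basis_def by (simp add: carrier_M)
next
  case False
  thus ?thesis
    unfolding is_module_basis_def prime.tate_basis_def by (auto simp: carrier_M)
qed

text \<open>The description ranges over all sizes, bases and matrices. The inner claim
  \<open>det\<close> evaluates every admissible choice to the same element, which settles
  uniqueness, and existence once one basis is at hand.\<close>

lemma module_det_tate:
  assumes u: "u \<in> drinfeld_End \<phi>" and d: "map_poly e d = closed.mdet (map_poly to_ac u)"
  shows "module_det R M (tate_map CARD('f) u) = adic_of l d"
proof -
  let ?u = "map_poly to_ac u"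
  have "skew_mult CARD('f) ?u closed.FT = skew_mult CARD('f) closed.FT ?u"
    using u by (simp add: drinfeld_End_def closed.FT_def flip: map_poly_to_ac_skew_mult)
  hence comm: "skew_mult CARD('f) ?u (F a) = skew_mult CARD('f) (F a) ?u" for a
    by (rule closed.commute_FT)
  have ev_act: "closed.ev ?u (closed.act a z) = closed.act a (closed.ev ?u z)" for a z
    by (simp add: closed.act_def comm flip: closed.ev_mult)
  have map: "tate_map CARD('f) u x = (\<lambda>m. closed.ev ?u (x m))" for x
    by (simp add: tate_map_def skew_eval_eq)
  have map_closed: "tate_map CARD('f) u x \<in> carrier M" if "x \<in> carrier M" for x
    using that by (auto simp: map carrier_M prime.tate_def closed.tors_def simp flip: ev_act)
  show ?thesis
    unfolding module_det_def
  proof (rule the_equality)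
    obtain b where b: "prime.tate_basis r b" using prime.tate_basis_exists by blast
    have bM: "b i \<in> carrier M" if "i < r" for i
      using b that by (simp add: prime.tate_basis_def carrier_M)
    have "\<exists>c. (\<forall>i<r. c i \<in> carrier R) \<and>
        tate_map CARD('f) u (b j) = (\<Oplus>\<^bsub>M\<^esub>i\<in>{..<r}. c i \<odot>\<^bsub>M\<^esub> b i)" if "j < r" for j
    proof -
      have "\<exists>!c. c \<in> {..<r} \<rightarrow>\<^sub>E carrier R \<and>
          tate_map CARD('f) u (b j) = (\<Oplus>\<^bsub>M\<^esub>i\<in>{..<r}. c i \<odot>\<^bsub>M\<^esub> b i)"
        using b map_closed[OF bM[OF that]] by (simp add: is_module_basis_def flip: is_module_basis_iff)
      thus ?thesis by (auto dest!: ex1_implies_ex)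
    qed
    hence "\<forall>j. \<exists>c. j < r \<longrightarrow> (\<forall>i<r. c i \<in> carrier R) \<and>
        tate_map CARD('f) u (b j) = (\<Oplus>\<^bsub>M\<^esub>i\<in>{..<r}. c i \<odot>\<^bsub>M\<^esub> b i)"
      by blast
    from choice[OF this] obtain A' where
      "\<forall>j. j < r \<longrightarrow> (\<forall>i<r. A' j i \<in> carrier R) \<and>
        tate_map CARD('f) u (b j) = (\<Oplus>\<^bsub>M\<^esub>i\<in>{..<r}. A' j i \<odot>\<^bsub>M\<^esub> b i)" ..
    hence A': "A' j i \<in> carrier R"
        "tate_map CARD('f) u (b j) = (\<Oplus>\<^bsub>M\<^esub>i\<in>{..<r}. A' j i \<odot>\<^bsub>M\<^esub> b i)"
      if "j < r" "i < r" for j i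
      using that by blast+
    have det: "ring_det R n A = adic_of l d"
      if "is_module_basis R M n b" and A: "\<And>i j. i < n \<Longrightarrow> j < n \<Longrightarrow> A i j \<in> carrier R"
        and f: "\<And>j. j < n \<Longrightarrow> tate_map CARD('f) u (b j) = (\<Oplus>\<^bsub>M\<^esub>i\<in>{..<n}. A i j \<odot>\<^bsub>M\<^esub> b i)" for n b A
    proof
      fix m
      have b: "prime.tate_basis n b" using that(1) by (simp add: is_module_basis_iff)
      have n: "n = r" by (rule prime.tate_basis_rank[OF b])
      have bM: "b i \<in> carrier M" if "i < n" for i
        using b that by (simp add: prime.tate_basis_def carrier_M)
      have "closed.ev ?u (b j m) = (\<Sum>i<n. closed.act (A i j m) (b i m))" if "j < n" for j m
        using f[OF that] A that bM by (simp add: map lincomb_M fun_eq_iff)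
      from prime.tate_det[OF b[unfolded n] comm this[unfolded n] d]
      show "ring_det R n A m = adic_of l d m"
        using A by (simp add: ring_det_adic_ring adic_of_def n)
    qed
    show "\<exists>n b A. is_module_basis R M n b \<and> (\<forall>i<n. \<forall>j<n. A i j \<in> carrier R) \<and>
        (\<forall>j<n. tate_map CARD('f) u (b j) = (\<Oplus>\<^bsub>M\<^esub>i\<in>{..<n}. A i j \<odot>\<^bsub>M\<^esub> b i)) \<and>
        adic_of l d = ring_det R n A"
    proof (intro exI conjI)
      show "is_module_basis R M r b" using b by (simp add: is_module_basis_iff)
      show A: "\<forall>i<r. \<forall>j<r. A' j i \<in> carrier R" using A'(1) by blast
      show f: "\<forall>j<r. tate_map CARD('f) u (b j) = (\<Oplus>\<^bsub>M\<^esub>i\<in>{..<r}. A' j i \<odot>\<^bsub>M\<^esub> b i)"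
        using A'(2) by blast
      show "adic_of l d = ring_det R r (\<lambda>i j. A' j i)"
        by (rule det[symmetric, of r b]) (use b A f in \<open>auto simp: is_module_basis_iff\<close>)
    qed
    fix d' assume "\<exists>n b A. is_module_basis R M n b \<and> (\<forall>i<n. \<forall>j<n. A i j \<in> carrier R) \<and>
        (\<forall>j<n. tate_map CARD('f) u (b j) = (\<Oplus>\<^bsub>M\<^esub>i\<in>{..<n}. A i j \<odot>\<^bsub>M\<^esub> b i)) \<and>
        d' = ring_det R n A"
    thus "d' = adic_of l d" using det by blast
  qed
qed

end

section \<open>The determinant as an element of F_q[T]\<close>

context drinfeld
begin

lemma drinfeld_det_eq:
  assumes u: "u \<in> drinfeld_End \<phi>" and d: "map_poly e d = closed.mdet (map_poly to_ac u)"
  shows "drinfeld_det \<iota> \<phi> u = d"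
proof -
  have det: "module_det (adic_ring l) (tate_module \<phi> l) (tate_map CARD('f) u) = adic_of l d"
    if "Factorial_Ring.irreducible l \<and> lead_coeff l = 1 \<and> l \<noteq> drinfeld_char \<iota> \<phi>" for l
  proof -
    have "drinfeld_prime e r F l"
      by (rule prime_locale) (use that in simp_all)
    hence "drinfeld_tate \<iota> r \<phi> l"
      by (intro drinfeld_tate.intro drinfeld_tate_axioms.intro drinfeld_axioms)
    thus ?thesis using u d by (rule drinfeld_tate.module_det_tate)
  qed
  show ?thesis
    unfolding drinfeld_det_def
  proof (rule the_equality)
    fix d' assume d': "\<forall>l. Factorial_Ring.irreducible l \<and> lead_coeff l = 1 \<and> l \<noteq> drinfeld_char \<iota> \<phi> \<longrightarrow>
       adic_of l d' = module_det (adic_ring l) (tate_module \<phi> l) (tate_map CARD('f) u)"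
    \<comment> \<open>X and X + 1 cannot both be the characteristic; one linear prime is enough to
      identify the polynomial.\<close>
    obtain c :: 'f where c: "[:c, 1:] \<noteq> drinfeld_char \<iota> \<phi>"
      by (metis pCons_eq_iff zero_neq_one)
    let ?l = "[:c, 1:]"
    have "Factorial_Ring.irreducible ?l" by (rule irreducible_linear_field_poly) simp
    hence "adic_of ?l d' = adic_of ?l d" using d' det[of ?l] c by simp
    \<comment> \<open>The power of the linear prime has degree m, above both degrees, so reduction
      changes neither polynomial.\<close>
    moreover define m where "m = Suc (max (degree d) (degree d'))"
    ultimately have "d' mod ?l ^ m = d mod ?l ^ m" by (metis adic_of_def)
    moreover have "degree (?l ^ m) = m" by (simp add: degree_power_eq)
    hence "d' mod ?l ^ m = d'" "d mod ?l ^ m = d" by (simp_all add: mod_poly_less m_def)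
    ultimately show "d' = d" by simp
  qed (use det in simp)
qed

theorem ext_degree_drinfeld_det:
  assumes "u \<in> drinfeld_End \<phi>"
  shows "ext_degree (drinfeld_det \<iota> \<phi> u) = ext_degree u"
proof -
  let ?u = "map_poly to_ac u"
  have "skew_mult CARD('f) ?u closed.FT = skew_mult CARD('f) closed.FT ?u"
    using assms by (simp add: drinfeld_End_def closed.FT_def flip: map_poly_to_ac_skew_mult)
  then obtain d where d: "map_poly e d = closed.mdet ?u"
    using closed.mdet_descends by blast
  have det: "drinfeld_det \<iota> \<phi> u = d" by (rule drinfeld_det_eq[OF assms d])
  show ?thesis
  proof (cases "u = 0")
    case True
    hence "d = 0" using d by (simp add: closed.mdet_0)
    thus ?thesis using True det by (simp add: ext_degree_def)
  next
    case False
    hence "?u \<noteq> 0" by (metis map_poly_to_ac_inj map_poly_0)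
    hence "closed.mdet ?u \<noteq> 0 \<and> degree (closed.mdet ?u) = degree ?u"
      by (rule closed.mdet_degree)
    hence "d \<noteq> 0" "degree d = degree u"
      by (auto simp: degree_map_poly simp flip: d)
    thus ?thesis using False det by (simp add: ext_degree_def)
  qed
qed

end

section \<open>Valuations\<close>

text \<open>The value of a fraction is w a - w b. Denominators have finite value, so the extended
  subtraction is meaningful, and cross multiplication shows independence of the chosen
  fraction.\<close>

lemma valuation_on_fraction_field:
  assumes val: "valuation_on R w" and frac: "is_fraction_field R K j"
  shows "\<exists>w'. valuation_on K w' \<and> (\<forall>u\<in>carrier R. w' (j u) = w u)"
proof -
  interpret R: domain R using val by (simp add: valuation_on_def)
  interpret K: Ring.field K using frac by (simp add: is_fraction_field_def)
  have hom: "j \<in> Ring.ring_hom R K" and inj: "inj_on j (carrier R)"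
    and frac_ex: "\<And>z. z \<in> carrier K \<Longrightarrow> \<exists>a\<in>carrier R. \<exists>b\<in>carrier R - {\<zero>\<^bsub>R\<^esub>}. z \<otimes>\<^bsub>K\<^esub> j b = j a"
    using frac by (simp_all add: is_fraction_field_def)
  interpret j: ring_hom_cring R K j
    by (intro ring_hom_cring.intro ring_hom_cring_axioms.intro R.cring_axioms K.cring_axioms hom)
  have w_ninf: "w x \<noteq> - \<infinity>" and w_inf: "w x = \<infinity> \<longleftrightarrow> x = \<zero>\<^bsub>R\<^esub>" if "x \<in> carrier R" for x
    using val that by (auto simp: valuation_on_def)
  have w_mult: "w (x \<otimes>\<^bsub>R\<^esub> y) = w x + w y" and w_add: "min (w x) (w y) \<le> w (x \<oplus>\<^bsub>R\<^esub> y)"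
    if "x \<in> carrier R" "y \<in> carrier R" for x y
    using val that by (auto simp: valuation_on_def)
  have w_real: "\<exists>s. w b = ereal s" if "b \<in> carrier R - {\<zero>\<^bsub>R\<^esub>}" for b
    using w_ninf[of b] w_inf[of b] that by (cases "w b") auto
  have j_nz: "j b \<noteq> \<zero>\<^bsub>K\<^esub>" if "b \<in> carrier R - {\<zero>\<^bsub>R\<^esub>}" for b
  proof
    assume "j b = \<zero>\<^bsub>K\<^esub>"
    hence "j b = j \<zero>\<^bsub>R\<^esub>" by simp
    from inj_onD[OF inj this] that show False by simp
  qed
  define rep where "rep z a b \<longleftrightarrow> a \<in> carrier R \<and> b \<in> carrier R - {\<zero>\<^bsub>R\<^esub>} \<and> z \<otimes>\<^bsub>K\<^esub> j b = j a" for z a b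
  define pair where "pair z = (SOME p. rep z (fst p) (snd p))" for z
  define w' where "w' z = w (fst (pair z)) - w (snd (pair z))" for z
  have w'_eq: "w' z = w a - w b" if z: "z \<in> carrier K" and ab: "rep z a b" for z a b
  proof -
    have "rep z (fst (pair z)) (snd (pair z))"
      unfolding pair_def by (rule someI[of _ "(a, b)"]) (use ab in simp)
    then obtain a' b' where w'z: "w' z = w a' - w b'" and ab': "rep z a' b'"
      unfolding w'_def by blast
    have carr: "a \<in> carrier R" "b \<in> carrier R" "a' \<in> carrier R" "b' \<in> carrier R"
      using ab ab' by (auto simp: rep_def)
    have "j (a \<otimes>\<^bsub>R\<^esub> b') = (z \<otimes>\<^bsub>K\<^esub> j b) \<otimes>\<^bsub>K\<^esub> j b'"
      using ab carr by (simp add: rep_def)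
    also have "\<dots> = (z \<otimes>\<^bsub>K\<^esub> j b') \<otimes>\<^bsub>K\<^esub> j b"
      using carr z by (simp add: K.m_ac)
    also have "\<dots> = j (a' \<otimes>\<^bsub>R\<^esub> b)"
      using ab' carr by (simp add: rep_def)
    finally have "a \<otimes>\<^bsub>R\<^esub> b' = a' \<otimes>\<^bsub>R\<^esub> b"
      by (rule inj_onD[OF inj]) (use carr in auto)
    from arg_cong[OF this, of w] have eq: "w a + w b' = w a' + w b"
      by (simp only: w_mult carr)
    obtain s t where "w b = ereal s" "w b' = ereal t"
      using w_real[of b] w_real[of b'] ab ab' by (auto simp: rep_def)
    thus ?thesis
      using eq w'z by (cases "w a"; cases "w a'") auto
  qed
  have rep_ex: "\<exists>a b. rep z a b" if "z \<in> carrier K" for z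
    using frac_ex[OF that] by (auto simp: rep_def)
  have "valuation_on K w'"
    unfolding valuation_on_def
  proof (intro conjI ballI)
    show "domain K" by (rule K.domain_axioms)
  next
    fix z assume z: "z \<in> carrier K"
    then obtain a b where ab: "rep z a b" using rep_ex by blast
    then obtain s where s: "w b = ereal s" using w_real by (auto simp: rep_def)
    have carr: "a \<in> carrier R" "b \<in> carrier R" using ab by (auto simp: rep_def)
    show "w' z \<noteq> - \<infinity>"
      using w'_eq[OF z ab] s w_ninf[OF carr(1)] by (cases "w a") auto
    have "w' z = \<infinity> \<longleftrightarrow> a = \<zero>\<^bsub>R\<^esub>"
      using w'_eq[OF z ab] s w_ninf[OF carr(1)] w_inf[OF carr(1)] by (cases "w a") auto
    also have "\<dots> \<longleftrightarrow> j a = j \<zero>\<^bsub>R\<^esub>"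
      using inj_on_eq_iff[OF inj carr(1) R.zero_closed] by simp
    also have "\<dots> \<longleftrightarrow> z \<otimes>\<^bsub>K\<^esub> j b = \<zero>\<^bsub>K\<^esub>"
      using ab by (simp add: rep_def)
    also have "\<dots> \<longleftrightarrow> z = \<zero>\<^bsub>K\<^esub>"
      using K.integral_iff[OF z] j_nz[of b] carr ab by (auto simp: rep_def)
    finally show "w' z = \<infinity> \<longleftrightarrow> z = \<zero>\<^bsub>K\<^esub>" .
  next
    fix y z assume y: "y \<in> carrier K" and z: "z \<in> carrier K"
    obtain a b c d where ab: "rep y a b" and cd: "rep z c d"
      using rep_ex[OF y] rep_ex[OF z] by blast
    then obtain s t where st: "w b = ereal s" "w d = ereal t"
      using w_real[of b] w_real[of d] by (auto simp: rep_def)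
    have carr: "a \<in> carrier R" "b \<in> carrier R" "c \<in> carrier R" "d \<in> carrier R"
      and nz: "b \<noteq> \<zero>\<^bsub>R\<^esub>" "d \<noteq> \<zero>\<^bsub>R\<^esub>"
      and eqs: "y \<otimes>\<^bsub>K\<^esub> j b = j a" "z \<otimes>\<^bsub>K\<^esub> j d = j c"
      using ab cd by (auto simp: rep_def)
    have bd: "b \<otimes>\<^bsub>R\<^esub> d \<in> carrier R - {\<zero>\<^bsub>R\<^esub>}"
      using carr nz R.integral by blast
    have "(y \<otimes>\<^bsub>K\<^esub> z) \<otimes>\<^bsub>K\<^esub> j (b \<otimes>\<^bsub>R\<^esub> d) = (y \<otimes>\<^bsub>K\<^esub> j b) \<otimes>\<^bsub>K\<^esub> (z \<otimes>\<^bsub>K\<^esub> j d)"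
      using carr y z by (simp add: K.m_ac)
    hence "rep (y \<otimes>\<^bsub>K\<^esub> z) (a \<otimes>\<^bsub>R\<^esub> c) (b \<otimes>\<^bsub>R\<^esub> d)"
      using carr bd by (simp add: rep_def eqs)
    from w'_eq[OF _ this] show "w' (y \<otimes>\<^bsub>K\<^esub> z) = w' y + w' z"
      using w'_eq[OF y ab] w'_eq[OF z cd] carr y z st w_ninf[of a] w_ninf[of c]
      by (cases "w a"; cases "w c") (simp_all add: w_mult)
    \<comment> \<open>Over the common denominator, the estimate for the numerator is shifted by the
      finite value of that denominator.\<close>
    have "(y \<oplus>\<^bsub>K\<^esub> z) \<otimes>\<^bsub>K\<^esub> j (b \<otimes>\<^bsub>R\<^esub> d) =
        (y \<otimes>\<^bsub>K\<^esub> j b) \<otimes>\<^bsub>K\<^esub> j d \<oplus>\<^bsub>K\<^esub> (z \<otimes>\<^bsub>K\<^esub> j d) \<otimes>\<^bsub>K\<^esub> j b"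
      using carr y z by (simp add: K.l_distr) (simp add: K.m_ac)
    hence "rep (y \<oplus>\<^bsub>K\<^esub> z) (a \<otimes>\<^bsub>R\<^esub> d \<oplus>\<^bsub>R\<^esub> c \<otimes>\<^bsub>R\<^esub> b) (b \<otimes>\<^bsub>R\<^esub> d)"
      using carr bd by (simp add: rep_def eqs)
    hence "w' (y \<oplus>\<^bsub>K\<^esub> z) = w (a \<otimes>\<^bsub>R\<^esub> d \<oplus>\<^bsub>R\<^esub> c \<otimes>\<^bsub>R\<^esub> b) - w (b \<otimes>\<^bsub>R\<^esub> d)"
      using w'_eq y z by simp
    moreover have "min (w a + w d) (w c + w b) \<le> w (a \<otimes>\<^bsub>R\<^esub> d \<oplus>\<^bsub>R\<^esub> c \<otimes>\<^bsub>R\<^esub> b)"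
      using w_add[of "a \<otimes>\<^bsub>R\<^esub> d" "c \<otimes>\<^bsub>R\<^esub> b"] carr by (simp add: w_mult)
    ultimately show "min (w' y) (w' z) \<le> w' (y \<oplus>\<^bsub>K\<^esub> z)"
      using w'_eq[OF y ab] w'_eq[OF z cd] st carr
      by (cases "w a"; cases "w c"; cases "w (a \<otimes>\<^bsub>R\<^esub> d \<oplus>\<^bsub>R\<^esub> c \<otimes>\<^bsub>R\<^esub> b)")
        (auto simp: w_mult min_def split: if_splits)
  qed
  moreover have "w' (j u) = w u" if u: "u \<in> carrier R" for u
  proof -
    have one: "\<one>\<^bsub>R\<^esub> \<in> carrier R - {\<zero>\<^bsub>R\<^esub>}" by simp
    obtain s where s: "w \<one>\<^bsub>R\<^esub> = ereal s" using w_real[OF one] by blast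
    \<comment> \<open>A finite value equal to its own double is 0, so u over 1 keeps the value of
      u.\<close>
    have "w \<one>\<^bsub>R\<^esub> = w \<one>\<^bsub>R\<^esub> + w \<one>\<^bsub>R\<^esub>"
      using w_mult[OF R.one_closed R.one_closed] by simp
    hence "w \<one>\<^bsub>R\<^esub> = 0" using s by simp
    moreover have "rep (j u) u \<one>\<^bsub>R\<^esub>" using u one by (simp add: rep_def)
    ultimately show ?thesis using w'_eq[of "j u"] u by simp
  qed
  ultimately show ?thesis by blast
qed

lemma ext_degree_skew_mult: "q > 0 \<Longrightarrow> ext_degree (skew_mult q f g) = ext_degree f + ext_degree g"
proof (cases "f = 0 \<or> g = 0")
  case True
  assume "q > 0"
  hence "skew_mult q f 0 = 0" by (simp add: skew_mult_def power_0_left)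
  with True show ?thesis by (auto simp: ext_degree_def)
next
  case False
  thus ?thesis by (simp add: ext_degree_def skew_mult_nonzero degree_skew_mult)
qed

lemma ext_degree_add_le: "ext_degree (f + g) \<le> max (ext_degree f) (ext_degree g)"
  using degree_add_le_max[of f g] by (auto simp: ext_degree_def le_max_iff_disj)

section \<open>The ring F_q[v, \<phi>_T] and its valuation\<close>

context drinfeld
begin

lemma ring_skew_poly_ring: "ring (skew_poly_ring CARD('f) :: 'k poly ring)"
proof -
  let ?S = "skew_poly_ring CARD('f) :: 'k poly ring"
  interpret to_ac: field_hom "to_ac :: 'k \<Rightarrow> 'k alg_closure" by (rule field_hom_to_ac)
  interpret p: map_poly_inj_idom_hom "to_ac :: 'k \<Rightarrow> 'k alg_closure" ..
  have assoc: "skew_mult CARD('f) (skew_mult CARD('f) x y) z = skew_mult CARD('f) x (skew_mult CARD('f) y z)" for x y z :: "'k poly"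
    by (rule map_poly_to_ac_inj[THEN iffD1]) (simp only: map_poly_to_ac_skew_mult closed.smul_assoc)
  have one: "skew_mult CARD('f) 1 x = x" "skew_mult CARD('f) x 1 = x" for x :: "'k poly"
    by (rule map_poly_to_ac_inj[THEN iffD1],
      simp only: map_poly_to_ac_skew_mult p.hom_one closed.smul_one_left closed.smul_one_right)+
  have dist: "skew_mult CARD('f) (x + y) z = skew_mult CARD('f) x z + skew_mult CARD('f) y z"
    "skew_mult CARD('f) z (x + y) = skew_mult CARD('f) z x + skew_mult CARD('f) z y" for x y z :: "'k poly"
    by (rule map_poly_to_ac_inj[THEN iffD1],
      simp only: map_poly_to_ac_skew_mult p.hom_add closed.smul_add_left closed.smul_add_right)+
  show ?thesis
  proof (rule ringI)
    show "abelian_group ?S"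
    proof (rule abelian_groupI)
      fix x show "\<exists>y\<in>carrier ?S. y \<oplus>\<^bsub>?S\<^esub> x = \<zero>\<^bsub>?S\<^esub>"
        by (rule bexI[of _ "- x"]) (simp_all add: skew_poly_ring_def)
    qed (simp_all add: skew_poly_ring_def add_ac)
    show "Group.monoid ?S"
      by (rule monoidI) (simp_all add: skew_poly_ring_def assoc one)
  qed (simp_all add: skew_poly_ring_def dist)
qed

lemma const_commute: "skew_mult CARD('f) f [:\<iota> c:] = skew_mult CARD('f) [:\<iota> c:] f"
proof -
  interpret to_ac: field_hom "to_ac :: 'k \<Rightarrow> 'k alg_closure" by (rule field_hom_to_ac)
  have "skew_mult CARD('f) (map_poly to_ac f) [:e c:] = skew_mult CARD('f) [:e c:] (map_poly to_ac f)"
    by (rule closed.ev_inject) (simp add: closed.ev_mult closed.ev_e_scale)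
  moreover have "map_poly to_ac [:\<iota> c:] = [:e c:]"
    by (simp add: to_ac.map_poly_pCons_hom)
  ultimately show ?thesis
    by - (rule map_poly_to_ac_inj[THEN iffD1], simp only: map_poly_to_ac_skew_mult)
qed

text \<open>The centralizer of y is a subring, so it contains whatever its elements
  generate.\<close>

lemma generate_ring_commute:
  fixes x y :: "'k poly"
  assumes H: "\<And>h. h \<in> H \<Longrightarrow> skew_mult CARD('f) h y = skew_mult CARD('f) y h"
    and x: "x \<in> generate_ring (skew_poly_ring CARD('f)) H"
  shows "skew_mult CARD('f) x y = skew_mult CARD('f) y x"
proof -
  let ?S = "skew_poly_ring CARD('f) :: 'k poly ring"
  have mult: "skew_mult CARD('f) a b = a \<otimes>\<^bsub>?S\<^esub> b" for a b :: "'k poly"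
    by (simp add: skew_poly_ring_def)
  interpret ring ?S by (rule ring_skew_poly_ring)
  have carr: "z \<in> carrier ?S" for z by (simp add: skew_poly_ring_def)
  show ?thesis using x unfolding mult
  proof (induction rule: generate_ring.induct)
    case (eng_mult h1 h2)
    thus ?case by (metis m_assoc carr)
  qed (simp_all add: H[unfolded mult] carr l_minus r_minus l_distr r_distr)
qed

text \<open>Commutativity spreads in two rounds: from generators to all elements against a
  generator, then to all pairs. Commuting with the generator \<phi>_T is membership in
  End(\<phi>).\<close>

lemma
  assumes v: "v \<in> drinfeld_End \<phi>"
  shows domain_drinfeld_subring: "domain (drinfeld_subring \<iota> \<phi> v)"
    and drinfeld_subring_End: "carrier (drinfeld_subring \<iota> \<phi> v) \<subseteq> drinfeld_End \<phi>"
proof -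
  let ?S = "skew_poly_ring CARD('f) :: 'k poly ring"
  interpret ring ?S by (rule ring_skew_poly_ring)
  let ?H = "range (\<lambda>c. [:\<iota> c:]) \<union> {v, \<phi> [:0, 1:]}"
  let ?R = "drinfeld_subring \<iota> \<phi> v"
  have mult: "x \<otimes>\<^bsub>?S\<^esub> y = skew_mult CARD('f) x y" for x y by (simp add: skew_poly_ring_def)
  have R: "?R = ?S\<lparr>carrier := generate_ring ?S ?H\<rparr>" by (simp add: drinfeld_subring_def)
  have HH: "skew_mult CARD('f) h h' = skew_mult CARD('f) h' h" if "h \<in> ?H" "h' \<in> ?H" for h h'
    using that v const_commute by (auto simp: mult drinfeld_End_def)
  have GH: "skew_mult CARD('f) x h = skew_mult CARD('f) h x" if "x \<in> generate_ring ?S ?H" "h \<in> ?H" for x h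
    by (rule generate_ring_commute[OF HH]) (use that in auto)
  have comm: "skew_mult CARD('f) x y = skew_mult CARD('f) y x" if "x \<in> generate_ring ?S ?H" "y \<in> generate_ring ?S ?H" for x y
    by (rule generate_ring_commute[OF _ that(1)]) (use GH[OF that(2)] in auto)
  show "carrier ?R \<subseteq> drinfeld_End \<phi>"
    using GH[of _ "\<phi> [:0, 1:]"] by (auto simp: R drinfeld_End_def mult)
  have "ring ?R" unfolding R by (rule generate_ring_is_ring) (simp add: skew_poly_ring_def)
  then interpret R: ring ?R .
  have "cring ?R"
    by (intro cring.intro \<open>ring ?R\<close> R.monoid_comm_monoidI) (use comm in \<open>simp add: R mult\<close>)
  thus "domain ?R"
  proof (rule domain.intro)
    show "domain_axioms ?R"
      by unfold_locales (auto simp: R skew_poly_ring_def dest: skew_mult_nonzero)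
  qed
qed

text \<open>All elements are endomorphisms, so the degree of the determinant may be replaced by the
  degree in \<tau>; the sign turns the maximum in its additive law into a minimum.\<close>

lemma valuation_on_drinfeld_subring:
  assumes v: "v \<in> drinfeld_End \<phi>"
  shows "valuation_on (drinfeld_subring \<iota> \<phi> v) (\<lambda>u. - ext_degree (drinfeld_det \<iota> \<phi> u))"
proof -
  let ?R = "drinfeld_subring \<iota> \<phi> v"
  interpret R: domain ?R by (rule domain_drinfeld_subring[OF v])
  have deg: "ext_degree (drinfeld_det \<iota> \<phi> u) = ext_degree u" if "u \<in> carrier ?R" for u
    using ext_degree_drinfeld_det drinfeld_subring_End[OF v] that by blast
  have ops: "x \<otimes>\<^bsub>?R\<^esub> y = skew_mult CARD('f) x y" "x \<oplus>\<^bsub>?R\<^esub> y = x + y" "\<zero>\<^bsub>?R\<^esub> = 0" for x y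
    by (simp_all add: drinfeld_subring_def skew_poly_ring_def)
  show ?thesis
    unfolding valuation_on_def
  proof (intro conjI ballI R.domain_axioms)
    fix x assume x: "x \<in> carrier ?R"
    show "- ext_degree (drinfeld_det \<iota> \<phi> x) \<noteq> - \<infinity>" "- ext_degree (drinfeld_det \<iota> \<phi> x) = \<infinity> \<longleftrightarrow> x = \<zero>\<^bsub>?R\<^esub>"
      by (simp_all add: deg x ops, simp_all add: ext_degree_def)
    fix y assume y: "y \<in> carrier ?R"
    have "ext_degree (x \<otimes>\<^bsub>?R\<^esub> y) = ext_degree x + ext_degree y"
      unfolding ops by (rule ext_degree_skew_mult) (use closed.q_gt_1 in simp)
    thus "- ext_degree (drinfeld_det \<iota> \<phi> (x \<otimes>\<^bsub>?R\<^esub> y)) =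
        - ext_degree (drinfeld_det \<iota> \<phi> x) + - ext_degree (drinfeld_det \<iota> \<phi> y)"
      by (simp add: deg x y) (simp add: ext_degree_def)
    have "ext_degree (x \<oplus>\<^bsub>?R\<^esub> y) \<le> max (ext_degree x) (ext_degree y)"
      unfolding ops by (rule ext_degree_add_le)
    thus "min (- ext_degree (drinfeld_det \<iota> \<phi> x)) (- ext_degree (drinfeld_det \<iota> \<phi> y)) \<le>
        - ext_degree (drinfeld_det \<iota> \<phi> (x \<oplus>\<^bsub>?R\<^esub> y))"
      by (auto simp: deg x y max_def min_def split: if_splits)
  qed
qed

end

theorem theorem3p5:
  fixes \<iota> :: "'f::finite_field \<Rightarrow> 'k::finite_field"
    and \<phi> :: "'f poly \<Rightarrow> 'k poly"
    and r :: nat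
    and v :: "'k poly"
  assumes "drinfeld_module \<iota> r \<phi>"
    and "v \<in> drinfeld_End \<phi>"
  shows "ext_degree (drinfeld_det \<iota> \<phi> v) = ext_degree v
    \<and> valuation_on (drinfeld_subring \<iota> \<phi> v) (\<lambda>u. - ext_degree (drinfeld_det \<iota> \<phi> u))
    \<and> (\<forall>(K :: ('c, 'm) ring_scheme) j. is_fraction_field (drinfeld_subring \<iota> \<phi> v) K j \<longrightarrow>
        (\<exists>w. valuation_on K w \<and>
          (\<forall>u\<in>carrier (drinfeld_subring \<iota> \<phi> v).
             w (j u) = - ext_degree (drinfeld_det \<iota> \<phi> u))))"
proof -
  interpret drinfeld \<iota> r \<phi> by (rule drinfeld.intro) fact
  show ?thesis
    using ext_degree_drinfeld_det[OF assms(2)] valuation_on_drinfeld_subring[OF assms(2)]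
      valuation_on_fraction_field[OF valuation_on_drinfeld_subring[OF assms(2)]]
    by blast
qed

end
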